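(* Let $\sigma>0$ and let $m\ge n\ge 2$. Let $\widehat q_1\in\mathbb{R}^m$ be a fixed unit vector, and assume a QR-type process produces normalized columns $$\widehat q_i=\frac{x_i+y_i}{\|x_i+y_i\|_2}\in\mathbb{R}^m,\qquad x_i\in\operatorname{span}(\widehat Q_{1:i-1})^\perp,\qquad i=2,\ldots,n,$$ where $\widehat Q_{1:k}=[\widehat q_1,\ldots,\widehat q_k]$ and $\widehat Q=\widehat Q_{1:n}$. Assume that $\widehat Q_{1:i-1}$ has full column rank for every $i=2,\ldots,n$. Let $\mathcal F_{i-1}$ be the $\sigma$-algebra generated by $y_2,\ldots,y_{i-1}$. Suppose that for each $i=2,\ldots,n$ the vector $x_i$ is $\mathcal F_{i-1}$-measurable and the perturbation $y_i\sim N(0,\sigma^2I_m)$ is independent of $\mathcal F_{i-1}$. Let $\tau_i\in(0,1)$ for $i=2,\ldots,n$, and assume there are deterministic constants $\ell_i>0$ with $$\|x_i\|_2\ge\ell_i,\qquad i=2,\ldots,n.$$ Then, with probability at least $$1-\sum_{i=2}^n F'_{m-i+1,i-1}\left(\frac{(i-1)\tau_i^2}{(m-i+1)(1-\tau_i^2)};\frac{\ell_i^2}{\sigma^2}\right),$$ we have $$\kappa(\widehat Q)\le\prod_{i=2}^n\frac{1+\sqrt{1-\tau_i^2}}{\tau_i}.$$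
   Context: For a real matrix $A$, $\kappa(A)=\sigma_{\max}(A)/\sigma_{\min}(A)$ is the spectral condition number (ratio of largest to smallest singular value). $\operatorname{span}(\cdot)$ of a matrix is its column space. $N(0,\sigma^2I_m)$ is the centered Gaussian distribution on $\mathbb{R}^m$ with covariance $\sigma^2I_m$. $\mathcal F_1$ is the trivial $\sigma$-algebra. $F'_{d_1,d_2}(\cdot;\lambda)$ is the CDF of the noncentral $F$-distribution with numerator degrees of freedom $d_1$, denominator degrees of freedom $d_2$, and numerator noncentrality parameter $\lambda$, i.e. the distribution of $\frac{U/d_1}{V/d_2}$ with $U,V$ independent, $U$ noncentral chi-square with $d_1$ degrees of freedom and noncentrality $\lambda$ (the law of $\|\mu+Z\|_2^2$ with $Z\sim N(0,I_{d_1})$, $\|\mu\|_2^2=\lambda$), and $V$ (central) chi-square with $d_2$ degrees of freedom. *)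

theory Defs
  imports "HOL-Analysis.Analysis" "HOL-Probability.Probability"
begin

definition eigenvalues :: "real^'n^'n \<Rightarrow> real set" where
  "eigenvalues A = {c. \<exists>v. v \<noteq> 0 \<and> A *v v = c *\<^sub>R v}"

(* The min(rows, columns) singular values: the smaller of the two Gram matrices is used, so that
   0 is a singular value exactly when A does not have full rank. *)
definition singular_values :: "real^'n^'m \<Rightarrow> real set" where
  "singular_values A =
     (if CARD('n) \<le> CARD('m) then sqrt ` eigenvalues (transpose A ** A)
      else sqrt ` eigenvalues (A ** transpose A))"

definition sigma_max :: "real^'n^'m \<Rightarrow> real" where
  "sigma_max A = Max (singular_values A)"

definition sigma_min :: "real^'n^'m \<Rightarrow> real" where
  "sigma_min A = Min (singular_values A)"

(* Extended-real valued: the convention x / 0 = 0 on the reals would make rank-deficient matrices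
   perfectly conditioned. *)
definition cond_number :: "real^'n^'m \<Rightarrow> ereal" where
  "cond_number A = (if sigma_min A = 0 then \<infinity> else ereal (sigma_max A / sigma_min A))"

(* N(0, sigma^2 I); the second parameter of normal_density is the standard deviation. *)
definition isotropic_gaussian :: "real \<Rightarrow> (real^'m) measure" where
  "isotropic_gaussian \<sigma> =
     density lborel (\<lambda>v. ennreal (\<Prod>k\<in>UNIV. normal_density 0 \<sigma> (v $ k)))"

(* The law of |mu + Z|^2 for Z ~ N(0, I_d) on functions {..<d} -> real. By rotation invariance
   it depends on mu only through lam = |mu|^2; the representative mu = (sqrt lam, 0, ..., 0) is
   used. Meaningful for d >= 1 and lam >= 0. *)
definition noncentral_chi_square :: "nat \<Rightarrow> real \<Rightarrow> real measure" where
  "noncentral_chi_square d lam =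
     distr (PiM {..<d} (\<lambda>_. density lborel (\<lambda>t. ennreal (std_normal_density t)))) borel
       (\<lambda>z. \<Sum>k<d. ((if k = 0 then sqrt lam else 0) + z k)\<^sup>2)"

definition noncentral_F :: "nat \<Rightarrow> nat \<Rightarrow> real \<Rightarrow> real measure" where
  "noncentral_F d1 d2 lam =
     distr (noncentral_chi_square d1 lam \<Otimes>\<^sub>M noncentral_chi_square d2 0) borel
       (\<lambda>(u, v). (u / real d1) / (v / real d2))"

(* The sigma-algebra generated by y 2, ..., y k; it is trivial, {{}, space M}, for k < 2. *)
definition generated_sigma ::
    "'w measure \<Rightarrow> (nat \<Rightarrow> 'w \<Rightarrow> real^'m) \<Rightarrow> nat \<Rightarrow> 'w measure" where
  "generated_sigma M y k =
     sigma (space M) (\<Union>j\<in>{2..k}. sets (vimage_algebra (space M) (y j) borel))"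

(* Columns are indexed by the finite type 'n, and pos j is the position of column j. *)
definition matrix_of_columns :: "('n \<Rightarrow> nat) \<Rightarrow> (nat \<Rightarrow> real^'m) \<Rightarrow> real^'n^'m" where
  "matrix_of_columns pos q = (\<chi> r j. q (pos j) $ r)"

definition column_space :: "(nat \<Rightarrow> real^'m) \<Rightarrow> nat \<Rightarrow> (real^'m) set" where
  "column_space q k = span (q ` {1..k})"

definition full_column_rank :: "(nat \<Rightarrow> real^'m) \<Rightarrow> nat \<Rightarrow> bool" where
  "full_column_rank q k \<longleftrightarrow> dim (column_space q k) = k"

end

theory Submission
  imports Defs
begin

text \<open>If \<open>q\<^sub>i\<close> has distance at least \<open>\<tau>\<^sub>i\<close> from the span of its predecessors, it meets that span at an angle
  with cosine at most \<open>c\<^sub>i = sqrt (1 - \<tau>\<^sub>i\<^sup>2)\<close>, so adjoining it changes the extreme squared singular values by factors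
  at least \<open>1 - c\<^sub>i\<close> and at most \<open>1 + c\<^sub>i\<close>; this gives the bound on the condition number. Given the past, the squared
  distance of \<open>x\<^sub>i + y\<^sub>i\<close> from the \<open>(i-1)\<close>-dimensional span and the squared norm of its projection to the span are
  independent (noncentral) chi-square variables up to the factor \<open>\<sigma>\<^sup>2\<close>, so the distance of \<open>q\<^sub>i\<close> is below \<open>\<tau>\<^sub>i\<close> with
  probability given by a noncentral F distribution function, which decreases in the noncentrality parameter.
  A union bound over \<open>i\<close> finishes the argument.\<close>

section \<open>Condition numbers\<close>

text \<open>The span of the earlier columns is random, and no measurable choice of an orthonormal
  basis for it is made. Fubini asks only for a bound on almost every section, so the basis may be
  chosen freely once the past is fixed; the joint measurability that Fubini also needs comes from
  testing closeness to the span on countably many rational coefficient tuples. Origin of the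
  constants: put k = i - 1 and d = m - k, and let U and V be the squared lengths of the parts of
  (x_i + y_i) / \<sigma> orthogonal to the span and inside it. As x_i is orthogonal to the span, it
  shifts only U, whose noncentrality is |x_i|^2 / \<sigma>^2, while V is central. Distance at most
  \<tau> after normalization means U <= \<tau>^2 (U + V), that is (U / d) / (V / k) <= k \<tau>^2 /
  (d (1 - \<tau>^2)). Monotonicity in the noncentrality replaces the random |x_i| by the constant
  \<open>l i\<close>, so the section bound no longer depends on the past. A vanishing x_i + y_i
  would be normalized to 0, because 1 / 0 = 0, and is counted as a failure.\<close>

lemma symmetric_matrix_max_eigenvector:
  fixes S :: "real^'n^'n"
  assumes S: "transpose S = S"
  obtains v c where "norm v = 1" "S *v v = c *\<^sub>R v" "\<And>w. norm w = 1 \<Longrightarrow> w \<bullet> (S *v w) \<le> c"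
proof -
  let ?f = "\<lambda>w. w \<bullet> (S *v w)"
  have sym: "u \<bullet> (S *v w) = w \<bullet> (S *v u)" for u w
    using S by (metis dot_lmul_matrix inner_commute vector_transpose_matrix)
  have "\<exists>v\<in>sphere 0 1. \<forall>w\<in>sphere 0 1. ?f w \<le> ?f v"
    by (intro continuous_attains_sup continuous_intros matrix_vector_mult_linear_continuous_on)
       auto
  then obtain v where v: "norm v = 1" "\<And>w. norm w = 1 \<Longrightarrow> ?f w \<le> ?f v"
    by auto
  define c where "c = ?f v"
  have form: "?f w \<le> c * (w \<bullet> w)" for w
  proof (cases "w = 0")
    case False
    let ?u = "(1 / norm w) *\<^sub>R w"
    have "?f ?u = ?f w / (norm w)\<^sup>2"
      by (simp add: matrix_vector_mult_scaleR power2_eq_square)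
    moreover have "?f ?u \<le> c"
      unfolding c_def using False by (intro v(2)) simp
    ultimately show ?thesis
      using False by (simp add: divide_le_eq dot_square_norm)
  qed simp
  define r where "r = c *\<^sub>R v - S *v v"
  \<comment> \<open>The nonnegative form c * (w \<bullet> w) - w \<bullet> (S *v w) vanishes at v; moving from v along -r would make it negative unless r = 0.\<close>
  have "r \<bullet> r \<le> t * (c * (r \<bullet> r) - ?f r) / 2" if "t > 0" for t
  proof -
    have "?f (v - t *\<^sub>R r) = c - 2 * t * (r \<bullet> (S *v v)) + t\<^sup>2 * ?f r"
      by (simp add: matrix_vector_mult_diff_distrib matrix_vector_mult_scaleR inner_diff_left inner_diff_right
          sym[of v r] c_def power2_eq_square algebra_simps)
    moreover have "(v - t *\<^sub>R r) \<bullet> (v - t *\<^sub>R r) = 1 - 2 * t * (r \<bullet> v) + t\<^sup>2 * (r \<bullet> r)"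
      using v(1) by (simp add: inner_diff_left inner_diff_right inner_commute power2_eq_square algebra_simps norm_eq_1)
    moreover have "r \<bullet> r = c * (r \<bullet> v) - r \<bullet> (S *v v)"
      by (subst (2) r_def) (simp add: inner_diff_right)
    ultimately have *: "c - 2 * t * (r \<bullet> (S *v v)) + t\<^sup>2 * ?f r \<le> c * (1 - 2 * t * (r \<bullet> v) + t\<^sup>2 * (r \<bullet> r))"
        and rr: "r \<bullet> r = c * (r \<bullet> v) - r \<bullet> (S *v v)"
      using form[of "v - t *\<^sub>R r"] by metis+
    have "0 \<le> t * (t * (c * (r \<bullet> r) - ?f r) - 2 * (c * (r \<bullet> v) - r \<bullet> (S *v v)))"
      using * by (simp add: algebra_simps power2_eq_square)
    then have "0 \<le> t * (t * (c * (r \<bullet> r) - ?f r) - 2 * (r \<bullet> r))"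
      unfolding rr[symmetric] .
    then show ?thesis using that by (simp add: zero_le_mult_iff)
  qed
  moreover have "((\<lambda>t. t * (c * (r \<bullet> r) - ?f r) / 2) \<longlongrightarrow> 0) (at_right 0)"
    by (auto intro!: tendsto_eq_intros)
  ultimately have "r \<bullet> r \<le> 0"
    by (intro tendsto_lowerbound[where F="at_right (0::real)"])
       (auto simp: eventually_at_right_less eventually_at_filter intro: eventually_mono[OF eventually_at_right_less])
  then have "r = 0" by (metis inner_eq_zero_iff inner_ge_zero order_antisym)
  then show ?thesis
    using v by (intro that[of v c]) (auto simp: r_def c_def)
qed

text \<open>\<open>Max\<close> and \<open>Min\<close> in the definitions of the extreme singular
  values are meaningful only on finite sets. Eigenvectors to distinct eigenvalues are orthogonal,
  hence independent, so there are only finitely many.\<close>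

lemma finite_eigenvalues_symmetric:
  fixes S :: "real^'n^'n"
  assumes S: "transpose S = S"
  shows "finite (eigenvalues S)"
proof -
  have sym: "u \<bullet> (S *v w) = w \<bullet> (S *v u)" for u w
    using S by (metis dot_lmul_matrix inner_commute vector_transpose_matrix)
  have "\<forall>c\<in>eigenvalues S. \<exists>v. v \<noteq> 0 \<and> S *v v = c *\<^sub>R v"
    by (simp add: eigenvalues_def)
  then obtain e where e: "\<And>c. c \<in> eigenvalues S \<Longrightarrow> e c \<noteq> 0 \<and> S *v e c = c *\<^sub>R e c"
    by metis
  have orth: "e c \<bullet> e d = 0" if "c \<in> eigenvalues S" "d \<in> eigenvalues S" "c \<noteq> d" for c d
  proof -
    have "d * (e c \<bullet> e d) = c * (e c \<bullet> e d)"
      using sym[of "e c" "e d"] e[OF that(1)] e[OF that(2)] by (simp add: inner_commute)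
    with that show ?thesis by simp
  qed
  have inj: "inj_on e (eigenvalues S)"
    using orth e by (intro inj_onI) (metis inner_eq_zero_iff)
  have "independent (e ` eigenvalues S)"
    using e orth by (intro pairwise_orthogonal_independent) (auto simp: pairwise_def orthogonal_def)
  then have "finite (e ` eigenvalues S)"
    by (rule independent_imp_finite)
  then show ?thesis using inj finite_imageD by blast
qed

text \<open>The cardinality hypothesis selects the Gram matrix \<open>transpose A ** A\<close>,
  whose quadratic form is the square of \<open>norm (A *v w)\<close>. The singular values are
  therefore the values of this norm at unit eigenvectors, and its extremes over the whole sphere are
  attained at such vectors.\<close>

lemma singular_value_extremes:
  fixes A :: "real^'n^'m"
  assumes "CARD('n) \<le> CARD('m)"
  shows "\<exists>v. norm v = 1 \<and> norm (A *v v) = sigma_max A"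
    and "\<exists>v. norm v = 1 \<and> norm (A *v v) = sigma_min A"
    and "\<And>v. norm v = 1 \<Longrightarrow> norm (A *v v) \<le> sigma_max A"
    and "\<And>v. norm v = 1 \<Longrightarrow> sigma_min A \<le> norm (A *v v)"
proof -
  let ?S = "transpose A ** A"
  have S: "transpose ?S = ?S" by (simp add: matrix_transpose_mul)
  have form: "w \<bullet> (?S *v w) = (norm (A *v w))\<^sup>2" for w
    by (metis dot_lmul_matrix dot_square_norm matrix_vector_mul_assoc vector_transpose_matrix transpose_transpose inner_commute)
  have sv: "singular_values A = sqrt ` eigenvalues ?S"
    using assms by (simp add: singular_values_def)
  have fin: "finite (singular_values A)"
    unfolding sv using finite_eigenvalues_symmetric[OF S] by simp
  have val: "c = (norm (A *v v))\<^sup>2" if "norm v = 1" "?S *v v = c *\<^sub>R v" for v c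
    using form[of v] that by (simp add: norm_eq_1)
  have mem: "norm (A *v v) \<in> singular_values A" if "norm v = 1" "?S *v v = c *\<^sub>R v" for v c
    unfolding sv image_iff
  proof (intro bexI)
    show "norm (A *v v) = sqrt c" using val[OF that] by simp
    show "c \<in> eigenvalues ?S" using that by (auto simp: eigenvalues_def intro!: exI[of _ v])
  qed
  have ev: "\<exists>v. norm v = 1 \<and> s = norm (A *v v)" if s: "s \<in> singular_values A" for s
  proof -
    obtain c v where cv: "s = sqrt c" "v \<noteq> 0" "?S *v v = c *\<^sub>R v"
      using s unfolding sv eigenvalues_def by auto
    let ?u = "(1 / norm v) *\<^sub>R v"
    have "norm ?u = 1" "?S *v ?u = c *\<^sub>R ?u" using cv by (auto simp: matrix_vector_mult_scaleR)
    with val[OF this] cv show ?thesis by (intro exI[of _ ?u]) simp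
  qed
  obtain v c where v: "norm v = 1" "?S *v v = c *\<^sub>R v" "\<And>w. norm w = 1 \<Longrightarrow> w \<bullet> (?S *v w) \<le> c"
    using symmetric_matrix_max_eigenvector[OF S] by metis
  have vmax: "norm (A *v w) \<le> norm (A *v v)" if "norm w = 1" for w
    using v(3)[OF that] val[OF v(1,2)] form[of w] by (simp add: power2_le_iff_abs_le abs_le_square_iff)
  have 1: "sigma_max A = norm (A *v v)"
    unfolding sigma_max_def using fin mem[OF v(1,2)] ev vmax by (intro Max_eqI) auto
  \<comment> \<open>The least eigenvalue comes from maximizing the form of the negated
    matrix.\<close>
  have S': "transpose (- ?S) = - ?S"
    using S by (simp add: transpose_def vec_eq_iff)
  obtain v' c' where v': "norm v' = 1" "(- ?S) *v v' = c' *\<^sub>R v'" "\<And>w. norm w = 1 \<Longrightarrow> w \<bullet> ((- ?S) *v w) \<le> c'"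
    using symmetric_matrix_max_eigenvector[OF S'] by metis
  have neg: "(- ?S) *v w = - (?S *v w)" for w
    by (simp add: matrix_vector_mult_def vec_eq_iff sum_negf)
  have v'': "?S *v v' = (- c') *\<^sub>R v'" "\<And>w. norm w = 1 \<Longrightarrow> w \<bullet> (?S *v w) \<ge> - c'"
    using v'(2) v'(3) by (simp_all add: neg minus_le_iff) (metis minus_minus)
  have vmin: "norm (A *v v') \<le> norm (A *v w)" if "norm w = 1" for w
    using v''(2)[OF that] val[OF v'(1) v''(1)] form[of w] by (simp add: power2_le_iff_abs_le abs_le_square_iff)
  have 2: "sigma_min A = norm (A *v v')"
    unfolding sigma_min_def using fin mem[OF v'(1) v''(1)] ev vmin by (intro Min_eqI) auto
  show "\<exists>v. norm v = 1 \<and> norm (A *v v) = sigma_max A" using 1 v by auto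
  show "\<exists>v. norm v = 1 \<and> norm (A *v v) = sigma_min A" using 2 v' by auto
  show "norm (A *v v) \<le> sigma_max A" if "norm v = 1" for v using 1 vmax that by simp
  show "sigma_min A \<le> norm (A *v v)" if "norm v = 1" for v using 2 vmin that by simp
qed

text \<open>A division-free form, suited both to estimates and to topology. The zero matrix
  satisfies all the inequalities and has to be excluded by hand; for any other rank-deficient matrix
  they fail, since \<open>sigma_min A = 0\<close> would force
  \<open>sigma_max A = 0\<close>.\<close>

lemma cond_number_le_iff:
  fixes A :: "real^'n^'m"
  assumes card: "CARD('n) \<le> CARD('m)"
  shows "cond_number A \<le> ereal K \<longleftrightarrow>
    A \<noteq> 0 \<and> (\<forall>u\<in>sphere 0 1. \<forall>v\<in>sphere 0 1. norm (A *v u) \<le> K * norm (A *v v))"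
proof -
  note ex = singular_value_extremes[OF card, where A=A]
  obtain u where u: "norm u = 1" "norm (A *v u) = sigma_max A" using ex(1) by auto
  obtain v where v: "norm v = 1" "norm (A *v v) = sigma_min A" using ex(2) by auto
  have smin: "0 \<le> sigma_min A" using v(2) by (metis norm_ge_zero)
  have smax0: "A = 0" if "sigma_max A = 0"
  proof -
    have "A *v w = 0" for w
    proof (cases "w = 0")
      case False
      have "norm (A *v ((1 / norm w) *\<^sub>R w)) \<le> 0"
        using ex(3)[of "(1 / norm w) *\<^sub>R w"] False that by simp
      with False show ?thesis by (simp add: matrix_vector_mult_scaleR divide_le_0_iff)
    qed simp
    then show ?thesis by (metis matrix_eq matrix_vector_mult_0)
  qed
  show ?thesis
  proof (intro iffI conjI ballI)
    assume "cond_number A \<le> ereal K"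
    then have pos: "sigma_min A > 0" and le: "sigma_max A / sigma_min A \<le> K"
      using smin by (auto simp: cond_number_def split: if_splits)
    have "K \<ge> 0"
      using le pos u(2) by (metis divide_nonneg_pos norm_ge_zero order_trans)
    show "A \<noteq> 0" using pos v by auto
    fix w z :: "real^'n" assume "w \<in> sphere 0 1" "z \<in> sphere 0 1"
    then have "norm (A *v w) \<le> sigma_max A" "sigma_min A \<le> norm (A *v z)" using ex by auto
    moreover have "sigma_max A \<le> K * sigma_min A" using le pos by (simp add: divide_le_eq)
    ultimately show "norm (A *v w) \<le> K * norm (A *v z)"
      using \<open>K \<ge> 0\<close> by (meson mult_left_mono order_trans)
  next
    assume *: "A \<noteq> 0 \<and> (\<forall>u\<in>sphere 0 1. \<forall>v\<in>sphere 0 1. norm (A *v u) \<le> K * norm (A *v v))"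
    then have le: "sigma_max A \<le> K * sigma_min A" using u v by (metis mem_sphere_0)
    have "sigma_min A \<noteq> 0"
    proof
      assume "sigma_min A = 0"
      with le have "sigma_max A = 0" using u(2) by (metis mult_zero_right norm_ge_zero order_antisym)
      with smax0 * show False by simp
    qed
    with le smin show "cond_number A \<le> ereal K"
      by (simp add: cond_number_def divide_le_eq)
  qed
qed

text \<open>Each inequality in \<open>cond_number_le_iff\<close> is a closed condition on the
  matrix, so even the uncountable intersection over pairs of unit vectors is closed.\<close>

lemma cond_number_le_borel:
  assumes card: "CARD('n) \<le> CARD('m)"
  shows "{A :: real^'n^'m. cond_number A \<le> ereal K} \<in> sets borel"
proof -
  have cont: "continuous_on UNIV (\<lambda>A :: real^'n^'m. norm (A *v u))" for u
    unfolding matrix_vector_mult_def by (intro continuous_intros)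
  have "{A :: real^'n^'m. cond_number A \<le> ereal K}
    = (- {0}) \<inter> (\<Inter>u\<in>sphere 0 1. \<Inter>v\<in>sphere 0 1. {A. norm (A *v u) \<le> K * norm (A *v v)})"
    by (auto simp: cond_number_le_iff[OF card])
  moreover have "closed (\<Inter>u\<in>sphere 0 1. \<Inter>v\<in>sphere 0 1. {A :: real^'n^'m. norm (A *v u) \<le> K * norm (A *v v)})"
    by (intro closed_INT ballI closed_Collect_le cont continuous_intros)
  ultimately show ?thesis by auto
qed

section \<open>Growth of squared norms when a column is adjoined\<close>

text \<open>The foot of the perpendicular from \<open>w\<close> to the line through a nonzero
  \<open>p\<close> has squared distance 1 minus the squared cosine of the angle. A sine of at least
  \<tau> thus leaves a cosine of at most \<open>sqrt (1 - \<tau>\<^sup>2)\<close>.\<close>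

lemma inner_le_if_far_from_line:
  fixes p w :: "'a::real_inner"
  assumes w: "norm w = 1" and far: "\<And>s. \<tau> \<le> norm (w - s *\<^sub>R p)" and "0 \<le> \<tau>"
  shows "\<bar>p \<bullet> w\<bar> \<le> sqrt (1 - \<tau>\<^sup>2) * norm p"
proof (cases "p = 0")
  case False
  let ?s = "(p \<bullet> w) / (p \<bullet> p)"
  have "\<tau>\<^sup>2 \<le> (norm (w - ?s *\<^sub>R p))\<^sup>2"
    using far[of ?s] assms(3) by (simp add: power_mono)
  also have "\<dots> = 1 - (p \<bullet> w)\<^sup>2 / (p \<bullet> p)"
    unfolding power2_norm_eq_inner
    using False w by (simp add: inner_diff_left inner_diff_right inner_commute norm_eq_1
       power2_eq_square field_simps)
  finally have "(p \<bullet> w)\<^sup>2 \<le> (1 - \<tau>\<^sup>2) * (p \<bullet> p)"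
    using False by (simp add: field_simps)
  then have "sqrt ((p \<bullet> w)\<^sup>2) \<le> sqrt ((1 - \<tau>\<^sup>2) * (p \<bullet> p))" by (rule real_sqrt_le_mono)
  then show ?thesis by (simp add: real_sqrt_mult norm_eq_sqrt_inner)
qed simp

text \<open>With \<open>c = sqrt (1 - \<tau>\<^sup>2)\<close>, a vector at distance at least \<open>\<tau>\<close> from the span of its predecessors
  multiplies the two bounds by \<open>1 - c\<close> and \<open>1 + c\<close>, and \<open>(1 + c) / (1 - c)\<close> is the square of \<open>(1 + c) / \<tau>\<close>.\<close>
lemma combination_norm_bounds:
  fixes q :: "nat \<Rightarrow> 'a::real_inner" and \<tau> :: "nat \<Rightarrow> real"
  assumes "1 \<le> k" and "norm (q 1) = 1"
    and "\<And>i. i \<in> {2..k} \<Longrightarrow> norm (q i) = 1"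
    and "\<And>i a. i \<in> {2..k} \<Longrightarrow> \<tau> i \<le> norm (q i - (\<Sum>j=1..i-1. a j *\<^sub>R q j))"
    and "\<And>i. i \<in> {2..k} \<Longrightarrow> 0 < \<tau> i \<and> \<tau> i < 1"
  shows "(\<Prod>i=2..k. 1 - sqrt (1 - (\<tau> i)\<^sup>2)) * (\<Sum>j=1..k. (a j)\<^sup>2) \<le> (norm (\<Sum>j=1..k. a j *\<^sub>R q j))\<^sup>2
    \<and> (norm (\<Sum>j=1..k. a j *\<^sub>R q j))\<^sup>2 \<le> (\<Prod>i=2..k. 1 + sqrt (1 - (\<tau> i)\<^sup>2)) * (\<Sum>j=1..k. (a j)\<^sup>2)"
  using assms
proof (induction k rule: dec_induct)
  case base
  then show ?case by (simp add: power_mult_distrib)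
next
  case (step k)
  let ?i = "Suc k"
  let ?L = "\<Prod>i=2..k. 1 - sqrt (1 - (\<tau> i)\<^sup>2)" and ?U = "\<Prod>i=2..k. 1 + sqrt (1 - (\<tau> i)\<^sup>2)"
  define p where "p = (\<Sum>j=1..k. a j *\<^sub>R q j)"
  define N where "N = (\<Sum>j=1..k. (a j)\<^sup>2)"
  define t where "t = a ?i"
  define c where "c = sqrt (1 - (\<tau> ?i)\<^sup>2)"
  have i: "?i \<in> {2..Suc k}" using step.hyps by simp
  have ti: "0 < \<tau> ?i" "\<tau> ?i < 1" using step.prems(4)[OF i] by auto
  have c: "0 \<le> c" "c \<le> 1" using ti by (auto simp: c_def power_le_one)
  have q: "norm (q ?i) = 1" using step.prems(2)[OF i] .
  have IH: "?L * N \<le> (norm p)\<^sup>2" "(norm p)\<^sup>2 \<le> ?U * N"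
    using step.IH step.prems by (auto simp: p_def N_def)
  have c_bounds: "0 \<le> 1 - sqrt (1 - (\<tau> i)\<^sup>2) \<and> 0 \<le> sqrt (1 - (\<tau> i)\<^sup>2)" if "i \<in> {2..k}" for i
    using step.prems(4)[of i] that by (auto simp: power_le_one)
  \<comment> \<open>The new coefficient enters \<open>(norm p)\<^sup>2 + t\<^sup>2\<close> with
    weight 1, which lies between the weights \<open>?L\<close> and \<open>?U\<close> of the old
    coefficients.\<close>
  have L: "?L \<le> 1" using c_bounds by (intro prod_le_1) auto
  have U: "1 \<le> ?U" using c_bounds by (intro prod_ge_1) auto
  have N0: "0 \<le> N" by (simp add: N_def sum_nonneg)
  have "\<bar>p \<bullet> q ?i\<bar> \<le> c * norm p"
    unfolding c_def
  proof (rule inner_le_if_far_from_line[OF q])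
    fix s
    \<comment> \<open>Every multiple of \<open>p\<close> is a combination of the earlier vectors, so
      the distance from their span bounds the distance from the line through
      \<open>p\<close>.\<close>
    show "\<tau> ?i \<le> norm (q ?i - s *\<^sub>R p)"
      using step.prems(3)[OF i, of "\<lambda>j. s * a j"] by (simp add: p_def scaleR_sum_right)
  qed (use ti in simp)
  then have "\<bar>t\<bar> * \<bar>p \<bullet> q ?i\<bar> \<le> \<bar>t\<bar> * (c * norm p)" by (intro mult_left_mono) auto
  then have "2 * \<bar>t * (p \<bullet> q ?i)\<bar> \<le> c * (2 * (\<bar>t\<bar> * norm p))" by (simp add: abs_mult algebra_simps)
  \<comment> \<open>By the arithmetic-geometric mean inequality, the cross term changes |p|^2 + t^2
    by a relative amount of at most \<open>c\<close>.\<close>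
  also have "\<dots> \<le> c * ((norm p)\<^sup>2 + t\<^sup>2)"
    using c sum_squares_bound[of "norm p" "\<bar>t\<bar>"] by (intro mult_left_mono) (auto simp: algebra_simps)
  finally have cross: "\<bar>2 * (t * (p \<bullet> q ?i))\<bar> \<le> c * ((norm p)\<^sup>2 + t\<^sup>2)" by (simp add: abs_mult)
  have sq: "(norm (p + t *\<^sub>R q ?i))\<^sup>2 = (norm p)\<^sup>2 + t\<^sup>2 + 2 * (t * (p \<bullet> q ?i))"
    unfolding power2_norm_eq_inner
    using q by (simp add: inner_add_left inner_add_right inner_commute norm_eq_1 power2_eq_square)
  have "?L * (N + t\<^sup>2) \<le> (norm p)\<^sup>2 + t\<^sup>2"
    using IH L mult_right_mono[OF L, of "t\<^sup>2"] by (simp add: algebra_simps)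
  then have "(1 - c) * (?L * (N + t\<^sup>2)) \<le> (1 - c) * ((norm p)\<^sup>2 + t\<^sup>2)"
    using c by (intro mult_left_mono) auto
  moreover have "(norm p)\<^sup>2 + t\<^sup>2 \<le> ?U * (N + t\<^sup>2)"
    using IH U mult_right_mono[OF U, of "t\<^sup>2"] by (simp add: algebra_simps)
  then have "(1 + c) * ((norm p)\<^sup>2 + t\<^sup>2) \<le> (1 + c) * (?U * (N + t\<^sup>2))"
    using c by (intro mult_left_mono) auto
  ultimately have "(1 - c) * (?L * (N + t\<^sup>2)) \<le> (norm (p + t *\<^sub>R q ?i))\<^sup>2
      \<and> (norm (p + t *\<^sub>R q ?i))\<^sup>2 \<le> (1 + c) * (?U * (N + t\<^sup>2))"
    using cross sq by (auto simp: abs_le_iff algebra_simps)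
  then show ?case
    using step.hyps by (simp add: p_def N_def t_def c_def algebra_simps)
qed

text \<open>A unit vector \<open>u\<close> gives coefficients with square sum 1, so the squared norm
  of \<open>?Q *v u\<close> lies between \<open>?L\<close> and \<open>?U\<close>. Since
  \<open>?U = ?K\<^sup>2 * ?L\<close>, any two such norms differ by a factor of at most
  \<open>?K\<close>.\<close>

lemma cond_number_le_prod:
  fixes q :: "nat \<Rightarrow> real^'m" and pos :: "'n::finite \<Rightarrow> nat"
  assumes card: "CARD('n) \<le> CARD('m)" and pos: "bij_betw pos UNIV {1..n}" and "1 \<le> n"
    and q: "norm (q 1) = 1" "\<And>i. i \<in> {2..n} \<Longrightarrow> norm (q i) = 1"
    and far: "\<And>i a. i \<in> {2..n} \<Longrightarrow> \<tau> i \<le> norm (q i - (\<Sum>j=1..i-1. a j *\<^sub>R q j))"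
    and \<tau>: "\<And>i. i \<in> {2..n} \<Longrightarrow> 0 < \<tau> i \<and> \<tau> i < 1"
  shows "cond_number (matrix_of_columns pos q) \<le> ereal (\<Prod>i=2..n. (1 + sqrt (1 - (\<tau> i)\<^sup>2)) / \<tau> i)"
proof -
  let ?Q = "matrix_of_columns pos q"
  let ?K = "\<Prod>i=2..n. (1 + sqrt (1 - (\<tau> i)\<^sup>2)) / \<tau> i"
  let ?L = "\<Prod>i=2..n. 1 - sqrt (1 - (\<tau> i)\<^sup>2)" and ?U = "\<Prod>i=2..n. 1 + sqrt (1 - (\<tau> i)\<^sup>2)"
  have bounds: "?L \<le> (norm (?Q *v u))\<^sup>2 \<and> (norm (?Q *v u))\<^sup>2 \<le> ?U" if "norm u = 1" for u
  proof -
    define a where "a i = u $ (inv_into UNIV pos i)" for i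
    have a: "a (pos j) = u $ j" for j
      using pos by (simp add: a_def bij_betw_def)
    have "?Q *v u = (\<Sum>j\<in>UNIV. u $ j *\<^sub>R q (pos j))"
      by (simp add: matrix_of_columns_def matrix_vector_mult_def vec_eq_iff mult.commute)
    also have "\<dots> = (\<Sum>i=1..n. a i *\<^sub>R q i)"
      by (subst sum.reindex_bij_betw[OF pos, symmetric]) (simp add: a)
    finally have 1: "?Q *v u = (\<Sum>i=1..n. a i *\<^sub>R q i)" .
    have "(\<Sum>i=1..n. (a i)\<^sup>2) = (\<Sum>j\<in>UNIV. (u $ j)\<^sup>2)"
      by (subst sum.reindex_bij_betw[OF pos, symmetric]) (simp add: a)
    also have "\<dots> = u \<bullet> u" by (simp add: inner_vec_def power2_eq_square)
    also have "\<dots> = 1" using that by (simp add: norm_eq_1)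
    finally have 2: "(\<Sum>i=1..n. (a i)\<^sup>2) = 1" .
    show ?thesis
      using combination_norm_bounds[where q=q and \<tau>=\<tau> and k=n and a=a] assms 1 2 by simp
  qed
  have c: "0 < 1 - sqrt (1 - (\<tau> i)\<^sup>2)" "0 \<le> sqrt (1 - (\<tau> i)\<^sup>2)" "0 < \<tau> i"
     "1 + sqrt (1 - (\<tau> i)\<^sup>2) = ((1 + sqrt (1 - (\<tau> i)\<^sup>2)) / \<tau> i)\<^sup>2 * (1 - sqrt (1 - (\<tau> i)\<^sup>2))"
    if "i \<in> {2..n}" for i
  proof -
    have t: "0 < \<tau> i" "\<tau> i < 1" using \<tau>[OF that] by auto
    have t2: "0 < (\<tau> i)\<^sup>2" "(\<tau> i)\<^sup>2 < 1" using t by (auto simp: power_less_one_iff)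
    show "0 < \<tau> i" by fact
    show "0 < 1 - sqrt (1 - (\<tau> i)\<^sup>2)" "0 \<le> sqrt (1 - (\<tau> i)\<^sup>2)" using t2 by auto
    define r where "r = sqrt (1 - (\<tau> i)\<^sup>2)"
    have r2: "r\<^sup>2 = 1 - (\<tau> i)\<^sup>2" using t2 by (simp add: r_def)
    then have "(1 + r) * (1 - r) = (\<tau> i)\<^sup>2" by (simp add: algebra_simps power2_eq_square)
    then have "((1 + r) / \<tau> i)\<^sup>2 * (1 - r) = 1 + r"
      using t by (simp add: power_divide power2_eq_square[of "1 + r"] mult.assoc)
    then show "1 + sqrt (1 - (\<tau> i)\<^sup>2) = ((1 + sqrt (1 - (\<tau> i)\<^sup>2)) / \<tau> i)\<^sup>2 * (1 - sqrt (1 - (\<tau> i)\<^sup>2))"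
      unfolding r_def by simp
  qed
  have L: "?L > 0" using c by (intro prod_pos) auto
  have K: "?K \<ge> 0" using c by (intro prod_nonneg) (auto intro!: divide_nonneg_pos add_nonneg_nonneg)
  have UL: "?U = ?K\<^sup>2 * ?L"
    unfolding prod_power_distrib prod.distrib[symmetric] using c by (intro prod.cong) auto
  show ?thesis
    unfolding cond_number_le_iff[OF card]
  proof (intro conjI ballI)
    obtain u :: "real^'n" where "norm u = 1" using vector_choose_size[of 1] by auto
    with bounds[OF this] L show "?Q \<noteq> 0" by auto
    fix u v :: "real^'n" assume "u \<in> sphere 0 1" "v \<in> sphere 0 1"
    then have "(norm (?Q *v u))\<^sup>2 \<le> ?U" "?L \<le> (norm (?Q *v v))\<^sup>2" using bounds by auto
    then have "(norm (?Q *v u))\<^sup>2 \<le> (?K * norm (?Q *v v))\<^sup>2"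
      unfolding UL power_mult_distrib by (meson mult_left_mono order_trans zero_le_power2)
    then show "norm (?Q *v u) \<le> ?K * norm (?Q *v v)"
      by (rule power2_le_imp_le) (use K in auto)
  qed
qed

section \<open>Gaussian vectors and the noncentral F distribution\<close>

lemma nn_integral_lborel_translate:
  fixes f :: "'a::euclidean_space \<Rightarrow> ennreal"
  assumes [measurable]: "f \<in> borel_measurable borel"
  shows "(\<integral>\<^sup>+x. f (c + x) \<partial>lborel) = (\<integral>\<^sup>+x. f x \<partial>lborel)"
proof -
  have "(\<integral>\<^sup>+x. f x \<partial>lborel) = (\<integral>\<^sup>+x. f x \<partial>distr lborel borel ((+) c))"
    by (simp add: lborel_distr_plus)
  also have "\<dots> = (\<integral>\<^sup>+x. f (c + x) \<partial>lborel)"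
    by (rule nn_integral_distr) auto
  finally show ?thesis by simp
qed

text \<open>The unit ball \<open>B\<close> has the same finite positive volume as its preimage under \<open>-T\<close>; integrate the function
  \<open>1\<^sub>A (T x) 1\<^sub>B (y - T x)\<close> over \<open>x\<close> and \<open>y\<close> in both orders.\<close>
lemma lborel_distr_orthogonal:
  fixes T :: "'a::euclidean_space \<Rightarrow> 'a"
  assumes T: "orthogonal_transformation T"
  shows "distr lborel borel T = lborel"
proof (rule measure_eqI)
  have lin: "linear T" using T by (rule orthogonal_transformation_linear)
  have [measurable]: "T \<in> borel_measurable borel"
    using lin by (intro borel_measurable_continuous_onI linear_continuous_on linear_conv_bounded_linear[THEN iffD1])
  fix A assume "A \<in> sets (distr lborel borel T)"
  then have [measurable]: "A \<in> sets borel" by simp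
  let ?B = "ball (0::'a) 1"
  have [measurable]: "?B \<in> sets borel" by simp
  have "(\<integral>\<^sup>+x. \<integral>\<^sup>+y. indicator A (T x) * indicator ?B (y - T x) \<partial>lborel \<partial>lborel)
      = (\<integral>\<^sup>+x. indicator A (T x) * emeasure lborel ?B \<partial>lborel)"
  proof (rule nn_integral_cong)
    fix x
    have "(\<integral>\<^sup>+y. indicator A (T x) * indicator ?B (y - T x) \<partial>lborel)
      = indicator A (T x) * (\<integral>\<^sup>+y. indicator ?B (- T x + y) \<partial>lborel)"
      by (subst nn_integral_cmult) simp_all
    also have "\<dots> = indicator A (T x) * (\<integral>\<^sup>+y. indicator ?B y \<partial>lborel)"
      by (subst nn_integral_lborel_translate) auto
    finally show "(\<integral>\<^sup>+y. indicator A (T x) * indicator ?B (y - T x) \<partial>lborel) =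
         indicator A (T x) * emeasure lborel ?B" by simp
  qed
  also have "\<dots> = (\<integral>\<^sup>+x. indicator (T -` A) x \<partial>lborel) * emeasure lborel ?B"
    by (subst nn_integral_multc[symmetric]) (auto simp: indicator_def vimage_def)
  also have "\<dots> = emeasure lborel (T -` A) * emeasure lborel ?B"
    using measurable_sets_borel[of T lborel A] by (subst nn_integral_indicator) auto
  finally have 1: "(\<integral>\<^sup>+x. \<integral>\<^sup>+y. indicator A (T x) * indicator ?B (y - T x) \<partial>lborel \<partial>lborel)
      = emeasure lborel (T -` A) * emeasure lborel ?B" .
  have "(\<integral>\<^sup>+x. \<integral>\<^sup>+y. indicator A (T x) * indicator ?B (y - T x) \<partial>lborel \<partial>lborel)
      = (\<integral>\<^sup>+y. \<integral>\<^sup>+x. indicator A (T x) * indicator ?B (y - T x) \<partial>lborel \<partial>lborel)"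
    by (rule lborel_pair.Fubini'[symmetric]) simp
  also have "\<dots> = (\<integral>\<^sup>+y. \<integral>\<^sup>+x. indicator A (T x + y) * indicator ?B x \<partial>lborel \<partial>lborel)"
  proof (rule nn_integral_cong)
    fix y
    \<comment> \<open>Translating x by the preimage of y turns T x into T x + y and y - T x into - T
      x, which lies in the ball exactly when x does, as T preserves norms.\<close>
    obtain z where z: "y = T z"
      using orthogonal_transformation_surj[OF T] by (metis surjD)
    have "(\<integral>\<^sup>+x. indicator A (T x) * indicator ?B (y - T x) \<partial>lborel)
      = (\<integral>\<^sup>+x. indicator A (T (z + x)) * indicator ?B (y - T (z + x)) \<partial>lborel)"
      by (subst nn_integral_lborel_translate[where f="\<lambda>x. indicator A (T x) * indicator ?B (y - T x)"]) auto
    also have "\<dots> = (\<integral>\<^sup>+x. indicator A (T x + y) * indicator ?B x \<partial>lborel)"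
      by (intro nn_integral_cong)
        (auto simp: indicator_def linear_add[OF lin] z add.commute orthogonal_transformation_norm[OF T])
    finally show "(\<integral>\<^sup>+x. indicator A (T x) * indicator ?B (y - T x) \<partial>lborel)
       = (\<integral>\<^sup>+x. indicator A (T x + y) * indicator ?B x \<partial>lborel)" .
  qed
  also have "\<dots> = (\<integral>\<^sup>+x. \<integral>\<^sup>+y. indicator A (T x + y) * indicator ?B x \<partial>lborel \<partial>lborel)"
    by (rule lborel_pair.Fubini') simp
  also have "\<dots> = (\<integral>\<^sup>+x. emeasure lborel A * indicator ?B x \<partial>lborel)"
  proof (rule nn_integral_cong)
    fix x
    have "(\<integral>\<^sup>+y. indicator A (T x + y) * indicator ?B x \<partial>lborel)
      = (\<integral>\<^sup>+y. indicator A (T x + y) \<partial>lborel) * indicator ?B x"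
      by (rule nn_integral_multc) auto
    then show "(\<integral>\<^sup>+y. indicator A (T x + y) * indicator ?B x \<partial>lborel)
      = emeasure lborel A * indicator ?B x"
      by (subst (asm) nn_integral_lborel_translate) auto
  qed
  also have "\<dots> = emeasure lborel A * emeasure lborel ?B"
    by (subst nn_integral_cmult) auto
  finally have "emeasure lborel (T -` A) * emeasure lborel ?B = emeasure lborel A * emeasure lborel ?B"
    using 1 by simp
  moreover have "emeasure lborel ?B \<noteq> \<infinity>"
    using emeasure_lborel_ball_finite[of "0::'a" 1] by simp
  moreover have "emeasure lborel ?B \<noteq> 0"
  proof
    assume "emeasure lborel ?B = 0"
    then have "?B \<in> null_sets lborel" by auto
    then have "negligible ?B" using negligible_iff_null_sets null_sets_completionI by blast
    then show False using open_not_negligible[of ?B] by simp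
  qed
  ultimately have "emeasure lborel (T -` A) = emeasure lborel A"
    by (metis ennreal_mult_cancel_left infinity_ennreal_def mult.commute)
  then show "emeasure (distr lborel borel T) A = emeasure lborel A"
    by (simp add: emeasure_distr)
qed simp

section \<open>Monotonicity of the chi-square distribution function in the noncentrality\<close>

abbreviation std_gaussian :: "real measure" where
  "std_gaussian \<equiv> density lborel (\<lambda>t. ennreal (std_normal_density t))"

lemma prob_space_std_gaussian: "prob_space std_gaussian"
  by (rule prob_space_normal_density) simp

lemma prob_space_noncentral_chi_square: "prob_space (noncentral_chi_square d \<mu>)"
  unfolding noncentral_chi_square_def
  by (intro prob_space.prob_space_distr prob_space_PiM prob_space_std_gaussian) measurable

lemma sets_noncentral_chi_square [simp, measurable_cong]: "sets (noncentral_chi_square d \<mu>) = sets borel"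
  by (simp add: noncentral_chi_square_def)

lemma space_noncentral_chi_square [simp]: "space (noncentral_chi_square d \<mu>) = UNIV"
  by (simp add: noncentral_chi_square_def)

text \<open>Reflection in the point \<open>c = -(s + t) / 2 \<le> 0\<close> exchanges the two intervals and moves
  the points that belong only to the one around \<open>-t\<close> closer to the origin.\<close>
lemma std_gaussian_interval_antimono:
  assumes "0 \<le> s" "s \<le> t"
  shows "emeasure std_gaussian {-t-a..-t+a} \<le> emeasure std_gaussian {-s-a..-s+a}"
proof -
  let ?I = "{-s-a..-s+a}" and ?J = "{-t-a..-t+a}"
  have le: "std_normal_density (- s - t - x) * indicator (?J - ?I) (- s - t - x) \<le> std_normal_density x * (indicator (?I - ?J) x :: real)" for x
  proof (cases "- s - t - x \<in> ?J - ?I")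
    case True
    then have x: "x \<in> ?I - ?J" using assms by auto
    have "-(s + t) \<le> 2 * x" using x assms by auto
    \<comment> \<open>This product is the difference between the squares of the reflected point and
      of \<open>x\<close>.\<close>
    then have "0 \<le> (s + t) * (s + t + 2 * x)" using assms by (intro mult_nonneg_nonneg) auto
    then have "x\<^sup>2 \<le> (- s - t - x)\<^sup>2" by (simp add: power2_eq_square algebra_simps)
    then have "std_normal_density (- s - t - x) \<le> std_normal_density x"
      by (simp add: std_normal_density_def mult_left_mono divide_right_mono)
    with True x show ?thesis by simp
  next
    case False
    then have "indicator (?J - ?I) (- s - t - x) = (0::real)" by (rule indicator_simps(2))
    moreover have "0 \<le> std_normal_density x * (indicator (?I - ?J) x :: real)"
      by (intro mult_nonneg_nonneg) auto
    ultimately show ?thesis by simp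
  qed
  have "emeasure std_gaussian (?J - ?I) = (\<integral>\<^sup>+x. ennreal (std_normal_density x * indicator (?J - ?I) x) \<partial>lborel)"
    by (subst emeasure_density) (simp_all add: ennreal_mult' ennreal_indicator)
  also have "\<dots> = (\<integral>\<^sup>+x. ennreal (std_normal_density (- s - t - x) * indicator (?J - ?I) (- s - t - x)) \<partial>lborel)"
    by (subst nn_integral_real_affine[where c="-1" and t="-s-t"]) auto
  also have "\<dots> \<le> (\<integral>\<^sup>+x. ennreal (std_normal_density x * indicator (?I - ?J) x) \<partial>lborel)"
    using le by (intro nn_integral_mono ennreal_leI)
  also have "\<dots> = emeasure std_gaussian (?I - ?J)"
    by (subst emeasure_density) (simp_all add: ennreal_mult' ennreal_indicator)
  finally have *: "emeasure std_gaussian (?J - ?I) \<le> emeasure std_gaussian (?I - ?J)" .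
  have split: "emeasure std_gaussian K = emeasure std_gaussian (K - L) + emeasure std_gaussian (K \<inter> L)"
    if "K \<in> sets borel" "L \<in> sets borel" for K L
  proof -
    have "(K - L) \<inter> (K \<inter> L) = {}" by blast
    then show ?thesis
      using plus_emeasure[of "K - L" std_gaussian "K \<inter> L"] that by (simp add: Un_Diff_Int)
  qed
  have "emeasure std_gaussian ?J = emeasure std_gaussian (?J - ?I) + emeasure std_gaussian (?I \<inter> ?J)"
    by (subst Int_commute) (rule split; simp)
  also have "\<dots> \<le> emeasure std_gaussian (?I - ?J) + emeasure std_gaussian (?I \<inter> ?J)"
    using * by (rule add_right_mono)
  also have "\<dots> = emeasure std_gaussian ?I"
    by (rule split[symmetric]) simp_all
  finally show ?thesis .
qed

lemma std_gaussian_shifted_square_antimono: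
  assumes "0 \<le> s" "s \<le> t"
  shows "emeasure std_gaussian {x. (t + x)\<^sup>2 \<le> r} \<le> emeasure std_gaussian {x. (s + x)\<^sup>2 \<le> r}"
proof (cases "0 \<le> r")
  case True
  have "(u + x)\<^sup>2 \<le> r \<longleftrightarrow> \<bar>u + x\<bar> \<le> sqrt r" for u x
    by (metis True abs_le_square_iff abs_of_nonneg real_sqrt_ge_0_iff real_sqrt_pow2)
  then have "{x. (u + x)\<^sup>2 \<le> r} = {- u - sqrt r..- u + sqrt r}" for u
    by (auto simp: abs_le_iff)
  then show ?thesis using std_gaussian_interval_antimono[OF assms] by simp
next
  case False
  then have "{x. (t + x)\<^sup>2 \<le> r} = {}" by (auto simp: not_le) (meson le_less_trans not_less zero_le_power2)
  then show ?thesis by simp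
qed

text \<open>The whole noncentrality sits in coordinate 0, which exists because
  \<open>1 \<le> d\<close>. With the other coordinates fixed, the event says that one shifted
  Gaussian square stays below a remainder, so the one-dimensional comparison applies under the
  integral, also when the remainder is negative.\<close>

lemma noncentral_chi_square_antimono:
  assumes "1 \<le> d" "0 \<le> \<mu>" "\<mu> \<le> \<nu>"
  shows "emeasure (noncentral_chi_square d \<nu>) {..r} \<le> emeasure (noncentral_chi_square d \<mu>) {..r}"
proof -
  interpret product_sigma_finite "\<lambda>_ :: nat. std_gaussian"
    by (intro product_sigma_finite.intro prob_space_imp_sigma_finite prob_space_std_gaussian)
  have d: "{..<d} = insert 0 {1..<d}" using assms by auto
  let ?S = "\<lambda>s z. \<Sum>k<d. ((if k = 0 then s else 0) + z k :: real)\<^sup>2"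
  let ?E = "\<lambda>s. {z \<in> space (PiM {..<d} (\<lambda>_. std_gaussian)). ?S s z \<le> r}"
  have sets: "?E s \<in> sets (PiM {..<d} (\<lambda>_. std_gaussian))" for s
    by measurable
  have eq: "emeasure (noncentral_chi_square d \<mu>') {..r}
     = (\<integral>\<^sup>+w. emeasure std_gaussian {t. (sqrt \<mu>' + t)\<^sup>2 \<le> r - (\<Sum>k\<in>{1..<d}. (w k)\<^sup>2)} \<partial>PiM {1..<d} (\<lambda>_. std_gaussian))" for \<mu>'
  proof -
    have "emeasure (noncentral_chi_square d \<mu>') {..r} = emeasure (PiM {..<d} (\<lambda>_. std_gaussian)) (?E (sqrt \<mu>'))"
      unfolding noncentral_chi_square_def by (subst emeasure_distr) (auto simp: vimage_def intro!: arg_cong2[where f=emeasure])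
    also have "\<dots> = (\<integral>\<^sup>+z. indicator (?E (sqrt \<mu>')) z \<partial>PiM {..<d} (\<lambda>_. std_gaussian))"
      using sets by simp
    also have "\<dots> = (\<integral>\<^sup>+w. \<integral>\<^sup>+t. indicator (?E (sqrt \<mu>')) (w(0 := t)) \<partial>std_gaussian \<partial>PiM {1..<d} (\<lambda>_. std_gaussian))"
      using sets unfolding d by (intro product_nn_integral_insert) auto
    also have "\<dots> = (\<integral>\<^sup>+w. emeasure std_gaussian {t. (sqrt \<mu>' + t)\<^sup>2 \<le> r - (\<Sum>k\<in>{1..<d}. (w k)\<^sup>2)} \<partial>PiM {1..<d} (\<lambda>_. std_gaussian))"
    proof (rule nn_integral_cong)
      fix w :: "nat \<Rightarrow> real" assume w: "w \<in> space (PiM {1..<d} (\<lambda>_. std_gaussian))"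
      have sp: "w(0 := t) \<in> space (PiM {..<d} (\<lambda>_. std_gaussian))" for t
        using w by (auto simp: d space_PiM PiE_def extensional_def)
      have "?S (sqrt \<mu>') (w(0 := t)) = (sqrt \<mu>' + t)\<^sup>2 + (\<Sum>k\<in>{1..<d}. (w k)\<^sup>2)" for t
        unfolding d by (subst sum.insert) auto
      then have "indicator (?E (sqrt \<mu>')) (w(0 := t)) = (indicator {t. (sqrt \<mu>' + t)\<^sup>2 \<le> r - (\<Sum>k\<in>{1..<d}. (w k)\<^sup>2)} t :: ennreal)" for t
        using sp[of t] by (auto simp: indicator_def algebra_simps)
      then show "(\<integral>\<^sup>+t. indicator (?E (sqrt \<mu>')) (w(0 := t)) \<partial>std_gaussian) = emeasure std_gaussian {t. (sqrt \<mu>' + t)\<^sup>2 \<le> r - (\<Sum>k\<in>{1..<d}. (w k)\<^sup>2)}"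
        by simp
    qed
    finally show ?thesis .
  qed
  show ?thesis
    unfolding eq using assms by (intro nn_integral_mono std_gaussian_shifted_square_antimono) auto
qed

section \<open>Gaussian vectors in orthonormal coordinates\<close>

lemma nn_integral_lborel_prod_cart:
  fixes h :: "'m::finite \<Rightarrow> real \<Rightarrow> ennreal"
  assumes [measurable]: "\<And>i. h i \<in> borel_measurable borel"
  shows "(\<integral>\<^sup>+w. (\<Prod>i\<in>UNIV. h i (w $ i)) \<partial>(lborel :: (real^'m) measure)) = (\<Prod>i\<in>UNIV. \<integral>\<^sup>+t. h i t \<partial>lborel)"
proof -
  let ?ax = "\<lambda>i::'m. axis i (1::real)"
  have inj: "inj ?ax" by (auto simp: inj_on_def axis_eq_axis)
  have B: "(Basis :: (real^'m) set) = range ?ax" by (auto simp: Basis_vec_def)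
  define g where "g b = h (inv ?ax b)" for b
  have g: "g (?ax i) = h i" for i by (simp add: g_def inv_f_f[OF inj])
  have "(\<integral>\<^sup>+w. (\<Prod>b\<in>Basis. g b (w \<bullet> b)) \<partial>(lborel :: (real^'m) measure)) = (\<Prod>b\<in>Basis. \<integral>\<^sup>+t. g b t \<partial>lborel)"
    by (rule nn_integral_lborel_prod) (auto simp: g_def)
  then show ?thesis
    unfolding B prod.reindex[OF inj] by (simp add: g inner_axis)
qed

text \<open>The density depends on \<open>v\<close> through its norm alone, hence is invariant under
  orthogonal transformations.\<close>

lemma prod_normal_density_eq:
  fixes v :: "real^'m"
  shows "(\<Prod>k\<in>UNIV. normal_density 0 \<sigma> (v $ k))
    = (1 / sqrt (2 * pi * \<sigma>\<^sup>2)) ^ CARD('m) * exp (- (norm v)\<^sup>2 / (2 * \<sigma>\<^sup>2))"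
proof -
  have "(norm v)\<^sup>2 = (\<Sum>k\<in>UNIV. (v $ k)\<^sup>2)"
    unfolding power2_norm_eq_inner inner_vec_def by (simp add: power2_eq_square)
  then show ?thesis
    by (simp add: normal_density_def prod.distrib exp_sum[symmetric] sum_negf sum_divide_distrib
       power_one_over prod_dividef)
qed

lemma orthonormal_coordinates_transformation:
  fixes b :: "'m::finite \<Rightarrow> real^'m"
  assumes b: "\<And>i j. b i \<bullet> b j = (if i = j then 1 else 0)"
  defines "T \<equiv> \<lambda>w :: real^'m. \<Sum>i\<in>UNIV. w $ i *\<^sub>R b i"
  shows "orthogonal_transformation T" and "T w \<bullet> b i = w $ i"
proof -
  show c: "T w \<bullet> b i = w $ i" for w i
    by (simp add: T_def inner_sum_left b if_distrib cong: if_cong)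
  show "orthogonal_transformation T"
    unfolding orthogonal_transformation_def
  proof (intro conjI allI)
    show "linear T"
      by (intro linearI) (auto simp: T_def scaleR_left_distrib sum.distrib scaleR_sum_right)
    fix v w
    have "T v \<bullet> T w = (\<Sum>i\<in>UNIV. w $ i * (T v \<bullet> b i))"
      by (subst (2) T_def) (simp add: inner_sum_right)
    then show "T v \<bullet> T w = v \<bullet> w" unfolding c by (simp add: inner_vec_def mult.commute)
  qed
qed

text \<open>Bridge between the index type \<open>'m\<close> of the coordinates and bases numbered
  from 0; the numbering is what later allows a basis to be cut into an initial and a final
  block.\<close>

lemma orthonormal_sequence_transformation:
  fixes b :: "nat \<Rightarrow> real^'m"
  assumes b: "\<And>i j. i < CARD('m) \<Longrightarrow> j < CARD('m) \<Longrightarrow> b i \<bullet> b j = (if i = j then 1 else 0)"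
  obtains f :: "'m \<Rightarrow> nat" and T where "bij_betw f UNIV {..<CARD('m)}" "orthogonal_transformation T"
    and "\<And>w i. T w \<bullet> b (f i) = w $ i"
proof -
  obtain e :: "nat \<Rightarrow> 'm" where e: "bij_betw e {..<CARD('m)} UNIV"
    using ex_bij_betw_nat_finite[of "UNIV :: 'm set"] by (auto simp: atLeast0LessThan)
  define f where "f = inv_into {..<CARD('m)} e"
  have f: "bij_betw f UNIV {..<CARD('m)}" using e by (simp add: f_def bij_betw_inv_into)
  have fl: "f i < CARD('m)" for i using f by (auto simp: bij_betw_def)
  have finj: "f i = f j \<longleftrightarrow> i = j" for i j using f by (auto simp: bij_betw_def inj_on_def)
  define T where "T = (\<lambda>w :: real^'m. \<Sum>i\<in>UNIV. w $ i *\<^sub>R b (f i))"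
  have T: "orthogonal_transformation T" and Tb: "\<And>w i. T w \<bullet> b (f i) = w $ i"
    unfolding T_def using orthonormal_coordinates_transformation[of "\<lambda>i. b (f i)"] b fl finj by auto
  show thesis by (rule that[OF f T Tb])
qed

lemma norm_orthonormal_coordinates:
  fixes b :: "nat \<Rightarrow> real^'m"
  assumes b: "\<And>i j. i < CARD('m) \<Longrightarrow> j < CARD('m) \<Longrightarrow> b i \<bullet> b j = (if i = j then 1 else 0)"
  shows "(norm v)\<^sup>2 = (\<Sum>j<CARD('m). (v \<bullet> b j)\<^sup>2)"
proof -
  obtain f T where f: "bij_betw f (UNIV :: 'm set) {..<CARD('m)}" and T: "orthogonal_transformation T"
    and Tb: "\<And>w i. T w \<bullet> b (f i) = w $ i"
    using orthonormal_sequence_transformation[OF b] by metis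
  obtain w where w: "v = T w"
    using orthogonal_transformation_surj[OF T] by (auto elim: surjE)
  have "(norm v)\<^sup>2 = (norm w)\<^sup>2"
    unfolding w orthogonal_transformation_norm[OF T] ..
  also have "\<dots> = (\<Sum>i\<in>UNIV. (w $ i)\<^sup>2)"
    unfolding power2_norm_eq_inner inner_vec_def by (simp add: power2_eq_square)
  also have "\<dots> = (\<Sum>i\<in>UNIV. (v \<bullet> b (f i))\<^sup>2)"
    unfolding w Tb ..
  also have "\<dots> = (\<Sum>j<CARD('m). (v \<bullet> b j)\<^sup>2)"
    by (rule sum.reindex_bij_betw[OF f])
  finally show ?thesis .
qed

lemma emeasure_std_gaussian_scaled:
  assumes "\<sigma> > 0" and [measurable]: "A \<in> sets borel"
  shows "(\<integral>\<^sup>+t. ennreal (normal_density 0 \<sigma> t) * indicator A (t / \<sigma>) \<partial>lborel) = emeasure std_gaussian A"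
proof -
  have "(\<integral>\<^sup>+t. ennreal (normal_density 0 \<sigma> t) * indicator A (t / \<sigma>) \<partial>lborel)
     = ennreal \<bar>\<sigma>\<bar> * (\<integral>\<^sup>+t. ennreal (normal_density 0 \<sigma> (\<sigma> * t)) * indicator A (\<sigma> * t / \<sigma>) \<partial>lborel)"
    using assms by (subst nn_integral_real_affine[where c=\<sigma> and t=0]) auto
  also have "\<dots> = (\<integral>\<^sup>+t. ennreal \<bar>\<sigma>\<bar> * (ennreal (normal_density 0 \<sigma> (\<sigma> * t)) * indicator A (\<sigma> * t / \<sigma>)) \<partial>lborel)"
    by (rule nn_integral_cmult[symmetric]) measurable
  also have "\<dots> = (\<integral>\<^sup>+t. ennreal (std_normal_density t) * indicator A t \<partial>lborel)"
  proof (rule nn_integral_cong)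
    fix t
    have "\<bar>\<sigma>\<bar> * normal_density 0 \<sigma> (\<sigma> * t) = std_normal_density t"
      using assms by (simp add: normal_density_def real_sqrt_mult power_mult_distrib)
    then show "ennreal \<bar>\<sigma>\<bar> * (ennreal (normal_density 0 \<sigma> (\<sigma> * t)) * indicator A (\<sigma> * t / \<sigma>)) = ennreal (std_normal_density t) * indicator A t"
      using assms by (simp add: mult.assoc[symmetric] ennreal_mult[symmetric])
  qed
  also have "\<dots> = emeasure std_gaussian A"
    by (subst emeasure_density) auto
  finally show ?thesis .
qed

text \<open>Product measures are determined by boxes. Both Lebesgue measure and the density are
  invariant under the orthogonal map to the basis \<open>b\<close>, so a box in these coordinates
  becomes a box in the standard ones, where the integral factors.\<close>

lemma isotropic_gaussian_coordinates:
  fixes b :: "nat \<Rightarrow> real^'m"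
  assumes "\<sigma> > 0"
    and b: "\<And>i j. i < CARD('m) \<Longrightarrow> j < CARD('m) \<Longrightarrow> b i \<bullet> b j = (if i = j then 1 else 0)"
  shows "distr (isotropic_gaussian \<sigma>) (PiM {..<CARD('m)} (\<lambda>_. std_gaussian))
      (\<lambda>v. \<lambda>j\<in>{..<CARD('m)}. (v \<bullet> b j) / \<sigma>) = PiM {..<CARD('m)} (\<lambda>_. std_gaussian)"
proof -
  let ?m = "CARD('m)"
  let ?P = "PiM {..<?m} (\<lambda>_. std_gaussian)"
  let ?X = "\<lambda>v :: real^'m. \<lambda>j\<in>{..<?m}. (v \<bullet> b j) / \<sigma>"
  interpret product_sigma_finite "\<lambda>_ :: nat. std_gaussian"
    by (intro product_sigma_finite.intro prob_space_imp_sigma_finite prob_space_std_gaussian)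
  have X [measurable]: "?X \<in> measurable borel ?P"
    by (rule measurable_restrict) simp
  have iso_sets [measurable_cong]: "sets (isotropic_gaussian \<sigma> :: (real^'m) measure) = sets borel"
    by (simp add: isotropic_gaussian_def)
  obtain f T where f: "bij_betw f (UNIV :: 'm set) {..<?m}" and T: "orthogonal_transformation T"
    and Tb: "\<And>w i. T w \<bullet> b (f i) = w $ i"
    using orthonormal_sequence_transformation[OF b] by metis
  have fl: "f i < ?m" for i using f by (auto simp: bij_betw_def)
  have [measurable]: "T \<in> borel_measurable borel"
    using orthogonal_transformation_linear[OF T]
    by (intro borel_measurable_continuous_onI linear_continuous_on linear_conv_bounded_linear[THEN iffD1])
  show ?thesis
  proof (rule PiM_eqI)
    fix A assume "\<And>i. i \<in> {..<?m} \<Longrightarrow> A i \<in> sets std_gaussian"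
    then have A: "A i \<in> sets borel" if "i < ?m" for i using that by auto
    then have A' [measurable]: "A (f i) \<in> sets borel" for i using fl by simp
    let ?R = "Pi\<^sub>E {..<?m} A"
    have R [measurable]: "?R \<in> sets ?P" using A by (intro sets_PiM_I_finite) auto
    let ?D = "\<lambda>v :: real^'m. ennreal (\<Prod>k\<in>UNIV. normal_density 0 \<sigma> (v $ k))"
    have D [measurable]: "?D \<in> borel_measurable borel" by measurable
    have "emeasure (distr (isotropic_gaussian \<sigma>) ?P ?X) ?R = emeasure (isotropic_gaussian \<sigma>) (?X -` ?R)"
      using R by (subst emeasure_distr) (auto simp: isotropic_gaussian_def)
    also have "\<dots> = (\<integral>\<^sup>+v. ?D v * indicator (?X -` ?R) v \<partial>lborel)"
      unfolding isotropic_gaussian_def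
      using measurable_sets[OF X R] by (subst emeasure_density) auto
    also have "\<dots> = (\<integral>\<^sup>+v. ?D v * indicator (?X -` ?R) v \<partial>distr lborel borel T)"
      by (simp add: lborel_distr_orthogonal[OF T])
    also have "\<dots> = (\<integral>\<^sup>+w. ?D (T w) * indicator (?X -` ?R) (T w) \<partial>lborel)"
      using measurable_sets[OF X R] by (subst nn_integral_distr) auto
    also have "\<dots> = (\<integral>\<^sup>+w. (\<Prod>i\<in>UNIV. ennreal (normal_density 0 \<sigma> (w $ i)) * indicator (A (f i)) (w $ i / \<sigma>)) \<partial>lborel)"
    proof (rule nn_integral_cong)
      fix w :: "real^'m"
      have 1: "?D (T w) = (\<Prod>i\<in>UNIV. ennreal (normal_density 0 \<sigma> (w $ i)))"
        unfolding prod_normal_density_eq orthogonal_transformation_norm[OF T]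
        unfolding prod_normal_density_eq[symmetric] by (simp add: prod_ennreal)
      have "T w \<in> ?X -` ?R \<longleftrightarrow> (\<forall>j\<in>{..<?m}. (T w \<bullet> b j) / \<sigma> \<in> A j)"
        by (auto simp: PiE_iff)
      also have "\<dots> \<longleftrightarrow> (\<forall>i. w $ i / \<sigma> \<in> A (f i))"
        unfolding bij_betw_imp_surj_on[OF f, symmetric] by (simp add: Tb)
      finally have 2: "indicator (?X -` ?R) (T w) = (\<Prod>i\<in>UNIV. indicator (A (f i)) (w $ i / \<sigma>) :: ennreal)"
        by (auto simp: indicator_def)
      show "?D (T w) * indicator (?X -` ?R) (T w) = (\<Prod>i\<in>UNIV. ennreal (normal_density 0 \<sigma> (w $ i)) * indicator (A (f i)) (w $ i / \<sigma>))"
        unfolding 1 2 by (rule prod.distrib[symmetric])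
    qed
    also have "\<dots> = (\<Prod>i\<in>UNIV. \<integral>\<^sup>+t. ennreal (normal_density 0 \<sigma> t) * indicator (A (f i)) (t / \<sigma>) \<partial>lborel)"
      by (rule nn_integral_lborel_prod_cart) measurable
    also have "\<dots> = (\<Prod>i\<in>UNIV. emeasure std_gaussian (A (f i)))"
      using emeasure_std_gaussian_scaled[OF assms(1) A'] by simp
    also have "\<dots> = (\<Prod>j\<in>{..<?m}. emeasure std_gaussian (A j))"
      by (rule prod.reindex_bij_betw[OF f])
    finally show "emeasure (distr (isotropic_gaussian \<sigma>) ?P ?X) ?R = (\<Prod>j\<in>{..<?m}. emeasure std_gaussian (A j))" .
  qed simp_all
qed

text \<open>The order of the basis matters: first the direction of \<open>x\<close>, then the rest
  of the orthogonal complement of \<open>W\<close>, and \<open>W\<close> itself last. The initial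
  block thus measures the distance from \<open>W\<close>, and \<open>x\<close> shifts only
  coordinate 0, as in \<open>noncentral_chi_square\<close>.\<close>

lemma orthonormal_basis_adapted:
  fixes x :: "'a::euclidean_space" and W :: "'a set"
  assumes W: "subspace W" and x: "x \<noteq> 0" and perp: "\<And>w. w \<in> W \<Longrightarrow> w \<bullet> x = 0"
  obtains b :: "nat \<Rightarrow> 'a"
  where "\<And>i j. i < DIM('a) \<Longrightarrow> j < DIM('a) \<Longrightarrow> b i \<bullet> b j = (if i = j then 1 else 0)"
    and "x = norm x *\<^sub>R b 0" and "\<And>j w. j < DIM('a) - dim W \<Longrightarrow> w \<in> W \<Longrightarrow> w \<bullet> b j = 0"
proof -
  let ?k = "dim W" and ?n = "DIM('a)"
  let ?V = "span (insert x W)"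
  let ?C = "{y. \<forall>z\<in>?V. orthogonal z y}"
  have "x \<notin> W" using perp[of x] x by auto
  then have dimV: "dim ?V = Suc ?k" using W by (simp add: dim_insert span_eq_iff[THEN iffD2])
  have "dim ?C + dim ?V = ?n"
    using dim_subspace_orthogonal_to_vectors[of ?V "UNIV :: 'a set"] by simp
  then have dims: "dim ?C = ?n - ?k - 1" "?k < ?n" using dimV by auto
  have C: "subspace ?C" by (rule subspace_orthogonal_to_vectors)
  obtain B2 where B2: "B2 \<subseteq> ?C" "pairwise orthogonal B2" "\<And>z. z \<in> B2 \<Longrightarrow> norm z = 1" "independent B2" "card B2 = dim ?C" "span B2 = ?C"
    by (rule orthonormal_basis_subspace[OF C]) blast
  obtain B1 where B1: "B1 \<subseteq> W" "pairwise orthogonal B1" "\<And>z. z \<in> B1 \<Longrightarrow> norm z = 1" "independent B1" "card B1 = dim W" "span B1 = W"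
    by (rule orthonormal_basis_subspace[OF W]) blast
  \<comment> \<open>Index 0 is reserved for the direction of \<open>x\<close>, which leaves
    \<open>?n - ?k - 1\<close> places for \<open>B2\<close>.\<close>
  have "card {1..<?n - ?k} = card B2" "card {?n - ?k..<?n} = card B1" using B1 B2 dims by auto
  moreover have "finite B1" "finite B2" using B1 B2 by (auto intro: independent_imp_finite)
  ultimately obtain g h where g: "bij_betw g {1..<?n - ?k} B2" and h: "bij_betw h {?n - ?k..<?n} B1"
    by (metis finite_same_card_bij finite_atLeastLessThan)
  define u where "u = (1 / norm x) *\<^sub>R x"
  define b where "b j = (if j = 0 then u else if j < ?n - ?k then g j else h j)" for j
  have gB: "g j \<in> B2" if "1 \<le> j" "j < ?n - ?k" for j using g that by (auto simp: bij_betw_def)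
  have hB: "h j \<in> B1" if "?n - ?k \<le> j" "j < ?n" for j using h that by (auto simp: bij_betw_def)
  have uu: "u \<bullet> u = 1" using x by (simp add: u_def dot_square_norm power2_eq_square)
  have ug: "u \<bullet> z = 0" if "z \<in> B2" for z
    using B2(1) that span_base[of x "insert x W"] by (auto simp: u_def orthogonal_def)
  have uh: "u \<bullet> z = 0" if "z \<in> B1" for z
    using perp[of z] B1(1) that by (auto simp: u_def inner_commute)
  have gW: "w \<bullet> z = 0" if "z \<in> B2" "w \<in> W" for z w
    using B2(1) that span_base[of w "insert x W"] by (auto simp: orthogonal_def)
  have gg: "g i \<bullet> g j = (if i = j then 1 else 0)" if "1 \<le> i" "i < ?n - ?k" "1 \<le> j" "j < ?n - ?k" for i j
  proof (cases "i = j")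
    case True then show ?thesis using B2(3)[OF gB[OF that(1,2)]] by (simp add: norm_eq_1)
  next
    case False
    then have "g i \<noteq> g j" using g that by (auto simp: bij_betw_def inj_on_def)
    then show ?thesis using B2(2) gB that False by (auto simp: pairwise_def orthogonal_def)
  qed
  have hh: "h i \<bullet> h j = (if i = j then 1 else 0)" if "?n - ?k \<le> i" "i < ?n" "?n - ?k \<le> j" "j < ?n" for i j
  proof (cases "i = j")
    case True then show ?thesis using B1(3)[OF hB[OF that(1,2)]] by (simp add: norm_eq_1)
  next
    case False
    then have "h i \<noteq> h j" using h that by (auto simp: bij_betw_def inj_on_def)
    then show ?thesis using B1(2) hB that False by (auto simp: pairwise_def orthogonal_def)
  qed
  have hg: "h i \<bullet> g j = 0" if "?n - ?k \<le> i" "i < ?n" "1 \<le> j" "j < ?n - ?k" for i j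
    using gW[OF gB[OF that(3,4)]] hB[OF that(1,2)] B1(1) by auto
  show thesis
  proof (rule that[of b])
    fix i j assume "i < ?n" "j < ?n"
    then show "b i \<bullet> b j = (if i = j then 1 else 0)"
      using uu ug[OF gB, of i] ug[OF gB, of j] uh[OF hB, of i] uh[OF hB, of j] gg[of i j] hh[of i j] hg[of i j] hg[of j i] dims
      by (auto simp: b_def inner_commute)
  next
    show "x = norm x *\<^sub>R b 0" using x by (simp add: b_def u_def)
  next
    fix j w assume "j < ?n - ?k" "w \<in> W"
    then show "w \<bullet> b j = 0"
      using gW[OF gB[of j], of w] perp[of w] by (auto simp: b_def u_def)
  qed
qed

section \<open>From blocks of Gaussian coordinates to the noncentral F distribution\<close>

lemma borel_measurable_emeasure_section:
  assumes "prob_space N" and [measurable_cong]: "sets N = sets borel" and [measurable]: "A \<in> sets (borel \<Otimes>\<^sub>M borel)"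
  shows "(\<lambda>w. emeasure N ((\<lambda>u. (u, w)) -` A)) \<in> borel_measurable (borel :: real measure)"
proof -
  interpret N: prob_space N by fact
  \<comment> \<open>\<open>lborel\<close> merely supplies a sigma-finite measure on the Borel sets;
    the resulting measurability in \<open>w\<close> involves only the sigma-algebra.\<close>
  interpret pair_sigma_finite N "lborel :: real measure" ..
  have "A \<in> sets (N \<Otimes>\<^sub>M lborel)" using assms by (simp cong: sets_pair_measure_cong)
  from measurable_emeasure_Pair2[OF this] show ?thesis by simp
qed

lemma emeasure_noncentral_chi_square_pair:
  assumes A: "A \<in> sets (borel \<Otimes>\<^sub>M borel)"
  shows "emeasure (noncentral_chi_square d \<mu> \<Otimes>\<^sub>M noncentral_chi_square k 0) A
    = (\<integral>\<^sup>+w. emeasure (noncentral_chi_square d \<mu>) ((\<lambda>u. (u, w)) -` A) \<partial>noncentral_chi_square k 0)"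
proof -
  interpret M1: prob_space "noncentral_chi_square d \<mu>" by (rule prob_space_noncentral_chi_square)
  interpret M2: prob_space "noncentral_chi_square k 0" by (rule prob_space_noncentral_chi_square)
  interpret pair_sigma_finite "noncentral_chi_square d \<mu>" "noncentral_chi_square k 0" ..
  show ?thesis
    using A by (intro emeasure_pair_measure_alt2) (simp cong: sets_pair_measure_cong)
qed

lemma borel_measurable_shifted_sum_of_squares:
  assumes "J \<subseteq> K"
  shows "(\<lambda>z. \<Sum>j\<in>J. (f j + z j)\<^sup>2) \<in> borel_measurable (PiM K (\<lambda>_. std_gaussian))"
proof (intro borel_measurable_sum borel_measurable_power borel_measurable_add borel_measurable_const)
  fix j assume "j \<in> J"
  then have "(\<lambda>z. z j) \<in> measurable (PiM K (\<lambda>_. std_gaussian)) std_gaussian"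
    using assms by (intro measurable_component_singleton) auto
  then show "(\<lambda>z. z j) \<in> borel_measurable (PiM K (\<lambda>_. std_gaussian))" by simp
qed

lemma sets_sum_of_squares_event:
  assumes A: "A \<in> sets (borel \<Otimes>\<^sub>M borel)" and "I \<subseteq> K" "J \<subseteq> K"
  shows "{z \<in> space (PiM K (\<lambda>_. std_gaussian)). (\<Sum>j\<in>J. (f j + z j)\<^sup>2, \<Sum>j\<in>I. (z j)\<^sup>2) \<in> A}
    \<in> sets (PiM K (\<lambda>_. std_gaussian))"
proof -
  have "(\<lambda>z. (\<Sum>j\<in>J. (f j + z j)\<^sup>2, \<Sum>j\<in>I. (0 + z j)\<^sup>2)) \<in> measurable (PiM K (\<lambda>_. std_gaussian)) (borel \<Otimes>\<^sub>M borel)"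
    using assms by (intro measurable_Pair borel_measurable_shifted_sum_of_squares)
  from measurable_sets[OF this A] show ?thesis
    by (simp add: vimage_def Int_def conj_commute)
qed

text \<open>The independence of the two sums of squares: they use disjoint blocks of a product
  measure, so Fubini over the blocks splits their joint law into a product.\<close>

lemma emeasure_ratio_noncentral_chi_square:
  assumes A [measurable]: "A \<in> sets (borel \<Otimes>\<^sub>M borel)" and m: "m = d + k"
  shows "emeasure (PiM {..<m} (\<lambda>_. std_gaussian))
      {z \<in> space (PiM {..<m} (\<lambda>_. std_gaussian)).
        (\<Sum>j<d. ((if j = 0 then sqrt \<mu> else 0) + z j)\<^sup>2, \<Sum>j\<in>{d..<m}. (z j)\<^sup>2) \<in> A}
    = emeasure (noncentral_chi_square d \<mu> \<Otimes>\<^sub>M noncentral_chi_square k 0) A"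
    (is "emeasure ?P ?E = _")
proof -
  interpret product_sigma_finite "\<lambda>_ :: nat. std_gaussian"
    by (intro product_sigma_finite.intro prob_space_imp_sigma_finite prob_space_std_gaussian)
  let ?I = "{d..<m}" and ?J = "{..<d}"
  let ?PI = "PiM ?I (\<lambda>_. std_gaussian)" and ?PJ = "PiM ?J (\<lambda>_. std_gaussian)"
  let ?S = "\<lambda>y. \<Sum>j<d. ((if j = 0 then sqrt \<mu> else 0) + y j :: real)\<^sup>2"
  define G where "G w = emeasure (noncentral_chi_square d \<mu>) ((\<lambda>u. (u, w)) -` A)" for w
  have G [measurable]: "G \<in> borel_measurable borel"
    unfolding G_def by (rule borel_measurable_emeasure_section[OF prob_space_noncentral_chi_square]) simp_all
  have un: "?I \<union> ?J = {..<m}" using m by auto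
  define E where "E = ?E"
  have E: "E \<in> sets ?P"
    unfolding E_def using m by (intro sets_sum_of_squares_event[OF A]) auto
  have "emeasure ?P ?E = (\<integral>\<^sup>+z. indicator E z \<partial>PiM (?I \<union> ?J) (\<lambda>_. std_gaussian))"
    unfolding un E_def[symmetric] by (rule nn_integral_indicator[OF E, symmetric])
  also have "\<dots> = (\<integral>\<^sup>+x. \<integral>\<^sup>+y. indicator E (merge ?I ?J (x, y)) \<partial>?PJ \<partial>?PI)"
    using borel_measurable_indicator[OF E] unfolding un[symmetric] by (intro product_nn_integral_fold) auto
  also have "\<dots> = (\<integral>\<^sup>+x. G (\<Sum>j\<in>?I. (x j)\<^sup>2) \<partial>?PI)"
  proof (rule nn_integral_cong)
    fix x assume x: "x \<in> space ?PI"
    let ?w = "\<Sum>j\<in>?I. (x j)\<^sup>2"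
    have sec: "(\<lambda>u. (u, ?w)) -` A \<in> sets borel"
      using measurable_sets[of "\<lambda>u. (u, ?w)" borel "borel \<Otimes>\<^sub>M borel" A] by simp
    have "(\<lambda>y. (?S y, ?w)) \<in> measurable ?PJ (borel \<Otimes>\<^sub>M borel)"
      by (intro measurable_Pair borel_measurable_shifted_sum_of_squares measurable_const) auto
    note secE = measurable_sets[OF this A]
    have "G ?w = emeasure ?PJ {y \<in> space ?PJ. (?S y, ?w) \<in> A}"
      unfolding G_def noncentral_chi_square_def
      using sec by (subst emeasure_distr) (auto simp: vimage_def intro!: arg_cong2[where f=emeasure])
    also have "\<dots> = (\<integral>\<^sup>+y. indicator {y \<in> space ?PJ. (?S y, ?w) \<in> A} y \<partial>?PJ)"
      using secE by (intro nn_integral_indicator[symmetric]) (simp add: vimage_def Int_def conj_commute)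
    also have "\<dots> = (\<integral>\<^sup>+y. indicator E (merge ?I ?J (x, y)) \<partial>?PJ)"
    proof (rule nn_integral_cong)
      fix y assume y: "y \<in> space ?PJ"
      have "merge ?I ?J (x, y) \<in> space ?P"
        using x y un by (auto simp: space_PiM PiE_def extensional_def merge_def Pi_iff)
      moreover have "?S (merge ?I ?J (x, y)) = ?S y"
        by (intro sum.cong) (auto simp: merge_def)
      moreover have "(\<Sum>j\<in>?I. (merge ?I ?J (x, y) j)\<^sup>2) = ?w"
        by (intro sum.cong) (auto simp: merge_def)
      ultimately show "indicator {y \<in> space ?PJ. (?S y, ?w) \<in> A} y = (indicator E (merge ?I ?J (x, y)) :: ennreal)"
        using y by (simp add: E_def indicator_def)
    qed
    finally show "(\<integral>\<^sup>+y. indicator E (merge ?I ?J (x, y)) \<partial>?PJ) = G ?w" by simp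
  qed
  also have "\<dots> = (\<integral>\<^sup>+w. G w \<partial>noncentral_chi_square k 0)"
  proof -
    \<comment> \<open>\<open>noncentral_chi_square\<close> numbers its coordinates from 0, so the
      final block is shifted down by \<open>d\<close>. At noncentrality 0 the offset
      \<open>sqrt 0\<close> of coordinate 0 disappears.\<close>
    let ?t = "\<lambda>\<omega> :: nat \<Rightarrow> real. \<lambda>n\<in>{..<k}. \<omega> (d + n)"
    have re: "distr ?PI (PiM {..<k} (\<lambda>_. std_gaussian)) ?t = PiM {..<k} (\<lambda>_. std_gaussian)"
      using m by (intro distr_PiM_reindex prob_space_std_gaussian) auto
    have t: "?t \<in> measurable ?PI (PiM {..<k} (\<lambda>_. std_gaussian))"
      using m by (intro measurable_restrict measurable_component_singleton) auto
    have "(\<integral>\<^sup>+w. G w \<partial>noncentral_chi_square k 0) = (\<integral>\<^sup>+z. G (\<Sum>j<k. (z j)\<^sup>2) \<partial>PiM {..<k} (\<lambda>_. std_gaussian))"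
      unfolding noncentral_chi_square_def by (subst nn_integral_distr) (auto intro!: nn_integral_cong arg_cong[where f=G] sum.cong)
    also have "\<dots> = (\<integral>\<^sup>+z. G (\<Sum>j<k. (z j)\<^sup>2) \<partial>distr ?PI (PiM {..<k} (\<lambda>_. std_gaussian)) ?t)"
      unfolding re ..
    also have "\<dots> = (\<integral>\<^sup>+x. G (\<Sum>j<k. (?t x j)\<^sup>2) \<partial>?PI)"
      using t by (subst nn_integral_distr) auto
    also have "\<dots> = (\<integral>\<^sup>+x. G (\<Sum>j\<in>?I. (x j)\<^sup>2) \<partial>?PI)"
    proof (rule nn_integral_cong)
      fix x :: "nat \<Rightarrow> real"
      have "bij_betw (\<lambda>j. d + j) {..<k} ?I"
        by (rule bij_betwI[where g="\<lambda>i. i - d"]) (use m in auto)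
      from sum.reindex_bij_betw[OF this, of "\<lambda>j. (x j)\<^sup>2"]
      show "G (\<Sum>j<k. (?t x j)\<^sup>2) = G (\<Sum>j\<in>?I. (x j)\<^sup>2)" by simp
    qed
    finally show ?thesis by simp
  qed
  also have "\<dots> = emeasure (noncentral_chi_square d \<mu> \<Otimes>\<^sub>M noncentral_chi_square k 0) A"
    unfolding G_def by (rule emeasure_noncentral_chi_square_pair[OF A, symmetric])
  finally show ?thesis .
qed

text \<open>The condition \<open>0 \<le> w\<close> makes the sections of the set initial segments of the line and covers the value
  \<open>u / 0 = 0\<close> of the quotient.\<close>
lemma noncentral_F_cdf_ge:
  assumes d: "1 \<le> d" "1 \<le> k" and lam: "0 \<le> \<mu>" "\<mu> \<le> \<nu>" and \<tau>: "0 < \<tau>" "\<tau> < 1"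
  shows "emeasure (noncentral_chi_square d \<nu> \<Otimes>\<^sub>M noncentral_chi_square k 0) {(u, w). 0 \<le> w \<and> (1 - \<tau>\<^sup>2) * u \<le> \<tau>\<^sup>2 * w}
    \<le> ennreal (cdf (noncentral_F d k \<mu>) ((real k * \<tau>\<^sup>2) / (real d * (1 - \<tau>\<^sup>2))))"
proof -
  let ?A = "{(u :: real, w :: real). 0 \<le> w \<and> (1 - \<tau>\<^sup>2) * u \<le> \<tau>\<^sup>2 * w}"
  let ?c = "(real k * \<tau>\<^sup>2) / (real d * (1 - \<tau>\<^sup>2))"
  let ?Q = "\<lambda>(u, w). (u / real d) / (w / real k)"
  have \<tau>2: "0 < 1 - \<tau>\<^sup>2" using \<tau> by (simp add: power_less_one_iff)
  interpret M1: prob_space "noncentral_chi_square d \<mu>" by (rule prob_space_noncentral_chi_square)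
  interpret M2: prob_space "noncentral_chi_square k 0" by (rule prob_space_noncentral_chi_square)
  interpret pair_prob_space "noncentral_chi_square d \<mu>" "noncentral_chi_square k 0" ..
  have "{z \<in> space (borel \<Otimes>\<^sub>M borel). 0 \<le> snd z \<and> (1 - \<tau>\<^sup>2) * fst z \<le> \<tau>\<^sup>2 * snd z} \<in> sets (borel \<Otimes>\<^sub>M (borel :: real measure))"
    by measurable
  also have "{z \<in> space (borel \<Otimes>\<^sub>M borel). 0 \<le> snd z \<and> (1 - \<tau>\<^sup>2) * fst z \<le> \<tau>\<^sup>2 * snd z} = ?A"
    by (auto simp: space_pair_measure)
  finally have A: "?A \<in> sets (borel \<Otimes>\<^sub>M borel)" .
  have sec: "(\<lambda>u. (u, w)) -` ?A = (if 0 \<le> w then {..\<tau>\<^sup>2 * w / (1 - \<tau>\<^sup>2)} else {})" for w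
    using \<tau>2 by (auto simp: pos_le_divide_eq mult.commute)
  have "emeasure (noncentral_chi_square d \<nu> \<Otimes>\<^sub>M noncentral_chi_square k 0) ?A
      \<le> emeasure (noncentral_chi_square d \<mu> \<Otimes>\<^sub>M noncentral_chi_square k 0) ?A"
    unfolding emeasure_noncentral_chi_square_pair[OF A] sec
    using noncentral_chi_square_antimono[OF d(1) lam] by (intro nn_integral_mono) simp
  also have "\<dots> \<le> emeasure (noncentral_chi_square d \<mu> \<Otimes>\<^sub>M noncentral_chi_square k 0)
      (?Q -` {..?c} \<inter> space (noncentral_chi_square d \<mu> \<Otimes>\<^sub>M noncentral_chi_square k 0))"
  proof (rule emeasure_mono)
    have "(u / real d) / (w / real k) \<le> ?c" if "0 \<le> w" "(1 - \<tau>\<^sup>2) * u \<le> \<tau>\<^sup>2 * w" for u w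
    proof (cases "w = 0")
      case True
      then show ?thesis using \<tau>2 by simp
    next
      case False
      with that have "u / w \<le> \<tau>\<^sup>2 / (1 - \<tau>\<^sup>2)" using \<tau>2 by (simp add: field_simps)
      then have "(real k / real d) * (u / w) \<le> (real k / real d) * (\<tau>\<^sup>2 / (1 - \<tau>\<^sup>2))"
        by (intro mult_left_mono) auto
      then show ?thesis by (simp add: mult.commute)
    qed
    then show "?A \<subseteq> ?Q -` {..?c} \<inter> space (noncentral_chi_square d \<mu> \<Otimes>\<^sub>M noncentral_chi_square k 0)"
      by (auto simp: space_pair_measure)
  qed (rule measurable_sets[where A=borel]; measurable)
  also have "\<dots> = emeasure (noncentral_F d k \<mu>) {..?c}"
    unfolding noncentral_F_def by (rule emeasure_distr[symmetric]) measurable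
  also have "\<dots> = ennreal (cdf (noncentral_F d k \<mu>) ?c)"
  proof -
    have "prob_space (noncentral_F d k \<mu>)"
      unfolding noncentral_F_def by (rule prob_space_distr) measurable
    then interpret F: prob_space "noncentral_F d k \<mu>" .
    show ?thesis by (simp add: cdf_def F.emeasure_eq_measure)
  qed
  finally show ?thesis .
qed

text \<open>The estimate for one column with the past frozen. The inequality in \<open>near\<close>
  is not strict, so that it also admits \<open>v = - x\<close>. The set \<open>B\<close> may be
  arbitrary, since it is only compared with the measurable preimage of \<open>?E\<close>.\<close>

lemma gaussian_near_subspace:
  fixes x :: "real^'m" and W :: "(real^'m) set"
  assumes W: "subspace W" "dim W = k" and k: "1 \<le> k" "k < CARD('m)"
    and \<sigma>: "0 < \<sigma>" and \<tau>: "0 < \<tau>" "\<tau> < 1" and l: "0 < l" "l \<le> norm x"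
    and perp: "\<And>w. w \<in> W \<Longrightarrow> w \<bullet> x = 0"
    and near: "\<And>v. v \<in> B \<Longrightarrow> \<exists>w\<in>W. norm (x + v - w) \<le> \<tau> * norm (x + v)"
  shows "emeasure (isotropic_gaussian \<sigma>) B
    \<le> ennreal (cdf (noncentral_F (CARD('m) - k) k (l\<^sup>2 / \<sigma>\<^sup>2)) ((real k * \<tau>\<^sup>2) / (real (CARD('m) - k) * (1 - \<tau>\<^sup>2))))"
proof -
  let ?m = "CARD('m)"
  let ?d = "?m - k"
  have x: "x \<noteq> 0" using l by auto
  obtain b :: "nat \<Rightarrow> real^'m" where
    b: "\<And>i j. i < DIM(real^'m) \<Longrightarrow> j < DIM(real^'m) \<Longrightarrow> b i \<bullet> b j = (if i = j then 1 else 0)"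
    and xb: "x = norm x *\<^sub>R b 0" and bW: "\<And>j w. j < DIM(real^'m) - dim W \<Longrightarrow> w \<in> W \<Longrightarrow> w \<bullet> b j = 0"
    using orthonormal_basis_adapted[OF W(1) x perp] by metis
  have b: "b i \<bullet> b j = (if i = j then 1 else 0)" if "i < ?m" "j < ?m" for i j using b that by simp
  have bW: "w \<bullet> b j = 0" if "j < ?d" "w \<in> W" for j w using bW that W by simp
  let ?P = "PiM {..<?m} (\<lambda>_. std_gaussian)"
  let ?X = "\<lambda>v. \<lambda>j\<in>{..<?m}. (v \<bullet> b j) / \<sigma>"
  let ?\<nu> = "(norm x)\<^sup>2 / \<sigma>\<^sup>2"
  let ?A = "{(u :: real, w :: real). 0 \<le> w \<and> (1 - \<tau>\<^sup>2) * u \<le> \<tau>\<^sup>2 * w}"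
  let ?E = "{z \<in> space ?P. (\<Sum>j<?d. ((if j = 0 then sqrt ?\<nu> else 0) + z j)\<^sup>2, \<Sum>j\<in>{?d..<?m}. (z j)\<^sup>2) \<in> ?A}"
  have norm_sum: "(norm v)\<^sup>2 = (\<Sum>j<?m. (v \<bullet> b j)\<^sup>2)" for v
    using b by (rule norm_orthonormal_coordinates)
  have law: "distr (isotropic_gaussian \<sigma>) ?P ?X = ?P"
    using \<sigma> b by (rule isotropic_gaussian_coordinates)
  have m0: "0 < ?m" by simp
  have split: "{..<?m} = {..<?d} \<union> {?d..<?m}" by auto
  have AX: "?X v \<in> ?E" if vB: "v \<in> B" for v
  proof -
    obtain w where w: "w \<in> W" "norm (x + v - w) \<le> \<tau> * norm (x + v)" using near[OF vB] by auto
    define U where "U = (\<Sum>j<?d. ((x + v) \<bullet> b j)\<^sup>2)"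
    define V where "V = (\<Sum>j\<in>{?d..<?m}. (v \<bullet> b j)\<^sup>2)"
    \<comment> \<open>Only coordinate 0 sees \<open>x\<close>, and \<open>k < CARD('m)\<close> puts
      index 0 into the initial block; hence the final block of \<open>x + v\<close> is that of
      \<open>v\<close>, and V is central.\<close>
    have xb0: "x \<bullet> b j = (if j = 0 then norm x else 0)" if "j < ?m" for j
      using b[OF m0 that] by (subst xb) auto
    have V': "V = (\<Sum>j\<in>{?d..<?m}. ((x + v) \<bullet> b j)\<^sup>2)"
      unfolding V_def using k by (intro sum.cong) (auto simp: inner_add_left xb0)
    have UV: "(norm (x + v))\<^sup>2 = U + V"
      unfolding norm_sum V' U_def split by (rule sum.union_disjoint) auto
    \<comment> \<open>Subtracting a point of \<open>W\<close> leaves the first \<open>?d\<close>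
      coordinates unchanged, so U bounds the squared distance to every such point from
      below.\<close>
    have "U = (\<Sum>j<?d. ((x + v - w) \<bullet> b j)\<^sup>2)"
      unfolding U_def using bW w by (intro sum.cong) (auto simp: inner_diff_left)
    also have "\<dots> \<le> (norm (x + v - w))\<^sup>2"
      unfolding norm_sum by (intro sum_mono2) auto
    also have "\<dots> \<le> (\<tau> * norm (x + v))\<^sup>2"
      using w by (intro power_mono) auto
    also have "\<dots> = \<tau>\<^sup>2 * (U + V)" by (simp add: power_mult_distrib UV)
    finally have ineq: "(1 - \<tau>\<^sup>2) * U \<le> \<tau>\<^sup>2 * V" by (simp add: algebra_simps)
    have "(\<Sum>j<?d. ((if j = 0 then sqrt ?\<nu> else 0) + ?X v j)\<^sup>2) = U / \<sigma>\<^sup>2"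
      unfolding U_def sum_divide_distrib
    proof (intro sum.cong refl)
      fix j assume "j \<in> {..<?d}"
      then have "j < ?m" by simp
      then have "((if j = 0 then sqrt ?\<nu> else 0) + ?X v j) = ((x + v) \<bullet> b j) / \<sigma>"
        using \<sigma> by (simp add: inner_add_left xb0 real_sqrt_divide add_divide_distrib)
      then show "((if j = 0 then sqrt ?\<nu> else 0) + ?X v j)\<^sup>2 = ((x + v) \<bullet> b j)\<^sup>2 / \<sigma>\<^sup>2"
        by (simp add: power_divide)
    qed
    moreover have "(\<Sum>j\<in>{?d..<?m}. (?X v j)\<^sup>2) = V / \<sigma>\<^sup>2"
      unfolding V_def sum_divide_distrib by (intro sum.cong) (auto simp: power_divide)
    moreover have "0 \<le> V / \<sigma>\<^sup>2" by (simp add: V_def sum_nonneg)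
    moreover have "(1 - \<tau>\<^sup>2) * (U / \<sigma>\<^sup>2) \<le> \<tau>\<^sup>2 * (V / \<sigma>\<^sup>2)"
      using divide_right_mono[OF ineq, of "\<sigma>\<^sup>2"] by simp
    ultimately show ?thesis by (simp add: space_PiM)
  qed
  have "{z \<in> space (borel \<Otimes>\<^sub>M borel). 0 \<le> snd z \<and> (1 - \<tau>\<^sup>2) * fst z \<le> \<tau>\<^sup>2 * snd z} \<in> sets (borel \<Otimes>\<^sub>M (borel :: real measure))"
    by measurable
  also have "{z \<in> space (borel \<Otimes>\<^sub>M borel). 0 \<le> snd z \<and> (1 - \<tau>\<^sup>2) * fst z \<le> \<tau>\<^sup>2 * snd z} = ?A"
    by (auto simp: space_pair_measure)
  finally have A [measurable]: "?A \<in> sets (borel \<Otimes>\<^sub>M borel)" .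
  have E: "?E \<in> sets ?P"
    by (intro sets_sum_of_squares_event[OF A]) auto
  have X: "?X \<in> measurable (isotropic_gaussian \<sigma>) ?P"
    unfolding isotropic_gaussian_def by (rule measurable_restrict) simp
  have "emeasure (isotropic_gaussian \<sigma>) B \<le> emeasure (isotropic_gaussian \<sigma>) (?X -` ?E \<inter> space (isotropic_gaussian \<sigma>))"
  proof (rule emeasure_mono[OF _ measurable_sets[OF X E]], intro subsetI IntI vimageI2)
    fix v assume "v \<in> B"
    then show "?X v \<in> ?E" by (rule AX)
    show "v \<in> space (isotropic_gaussian \<sigma>)" by (simp add: isotropic_gaussian_def)
  qed
  also have "\<dots> = emeasure ?P ?E"
    using emeasure_distr[OF X E] unfolding law by simp
  also have "\<dots> = emeasure (noncentral_chi_square ?d ?\<nu> \<Otimes>\<^sub>M noncentral_chi_square k 0) ?A"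
    using k by (intro emeasure_ratio_noncentral_chi_square[OF A]) simp
  \<comment> \<open>Here the actual noncentrality \<open>?\<nu>\<close> is lowered to the one
    obtained from \<open>l \<le> norm x\<close>.\<close>
  also have "\<dots> \<le> ennreal (cdf (noncentral_F ?d k (l\<^sup>2 / \<sigma>\<^sup>2)) ((real k * \<tau>\<^sup>2) / (real ?d * (1 - \<tau>\<^sup>2))))"
    using k l \<tau> by (intro noncentral_F_cdf_ge divide_right_mono power_mono) auto
  finally show ?thesis .
qed

section \<open>Conditioning on the past\<close>

lemma space_generated_sigma [simp]: "space (generated_sigma M y k) = space M"
  by (simp add: generated_sigma_def space_measure_of_conv)

lemma sets_generated_sigma:
  "sets (generated_sigma M y k) = sigma_sets (space M) (\<Union>j\<in>{2..k}. sets (vimage_algebra (space M) (y j) borel))"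
  unfolding generated_sigma_def
  using sets.sets_into_space[of _ "vimage_algebra (space M) (y _) borel"]
  by (intro sets_measure_of) (auto simp: space_vimage_algebra)

lemma sets_generated_sigma_mono: "k \<le> k' \<Longrightarrow> sets (generated_sigma M y k) \<subseteq> sets (generated_sigma M y k')"
  unfolding sets_generated_sigma by (intro sigma_sets_mono') force

lemma sets_generated_sigma_subset:
  assumes "\<And>j. j \<in> {2..k} \<Longrightarrow> y j \<in> borel_measurable M"
  shows "sets (generated_sigma M y k) \<subseteq> sets M"
  unfolding sets_generated_sigma
proof (rule sets.sigma_sets_subset, intro UN_least)
  fix j assume "j \<in> {2..k}"
  from assms[OF this] show "sets (vimage_algebra (space M) (y j) borel) \<subseteq> sets M"
    by (rule sets_image_in_sets[OF refl])
qed

lemma measurable_generated_sigma: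
  fixes y :: "nat \<Rightarrow> 'w \<Rightarrow> real^'m"
  assumes "j \<in> {2..k}"
  shows "y j \<in> borel_measurable (generated_sigma M y k)"
proof (rule measurableI)
  fix A assume "A \<in> sets (borel :: (real^'m) measure)"
  then have "y j -` A \<inter> space M \<in> sets (vimage_algebra (space M) (y j) borel)"
    by (rule in_vimage_algebra)
  with assms show "y j -` A \<inter> space (generated_sigma M y k) \<in> sets (generated_sigma M y k)"
    unfolding sets_generated_sigma by (auto intro!: sigma_sets.Basic)
qed simp

text \<open>Fubini on the joint law of \<open>Y\<close> and the identity into the coarser measurable space \<open>G\<close>; this replaces
  conditioning on the sigma-algebra of \<open>G\<close>.\<close>
lemma (in prob_space) prob_le_if_sections_le:
  assumes G: "space G = space M" "sets G \<subseteq> sets M" and Y: "Y \<in> borel_measurable M"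
    and ind: "indep_set (sets (vimage_algebra (space M) Y borel)) (sets G)"
    and E: "E \<in> sets (borel \<Otimes>\<^sub>M G)"
    and le: "AE \<omega> in M. emeasure (distr M borel Y) {v. (v, \<omega>) \<in> E} \<le> c"
  shows "emeasure M {\<omega> \<in> space M. (Y \<omega>, \<omega>) \<in> E} \<le> c"
proof -
  have id: "(\<lambda>\<omega>. \<omega>) \<in> measurable M G"
    using G sets.sets_into_space[of _ G] by (intro measurableI) (auto simp: Int_absorb2)
  interpret Y: prob_space "distr M borel Y" by (rule prob_space_distr[OF Y])
  interpret I: prob_space "distr M G (\<lambda>\<omega>. \<omega>)" by (rule prob_space_distr[OF id])
  interpret pair_sigma_finite "distr M borel Y" "distr M G (\<lambda>\<omega>. \<omega>)" ..
  \<comment> \<open>On rectangles the factorization is exactly the assumed independence, and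
    rectangles determine the product measure.\<close>
  have joint: "distr M borel Y \<Otimes>\<^sub>M distr M G (\<lambda>\<omega>. \<omega>) = distr M (borel \<Otimes>\<^sub>M G) (\<lambda>\<omega>. (Y \<omega>, \<omega>))"
  proof (rule pair_measure_eqI)
    fix A B assume "A \<in> sets (distr M borel Y)" "B \<in> sets (distr M G (\<lambda>\<omega>. \<omega>))"
    then have A: "A \<in> sets borel" and B: "B \<in> sets G" by auto
    have B': "B \<inter> space M = B" using sets.sets_into_space[OF B] G(1) by auto
    have YA: "Y -` A \<inter> space M \<in> sets M" using Y A by (rule measurable_sets)
    have pre: "(\<lambda>\<omega>. (Y \<omega>, \<omega>)) -` (A \<times> B) \<inter> space M = (Y -` A \<inter> space M) \<inter> B"
      using B' by auto
    have "prob ((Y -` A \<inter> space M) \<inter> B) = prob (Y -` A \<inter> space M) * prob B"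
      using ind in_vimage_algebra[OF A, of Y "space M"] B by (simp add: indep_sets2_eq)
    then show "emeasure (distr M borel Y) A * emeasure (distr M G (\<lambda>\<omega>. \<omega>)) B
        = emeasure (distr M (borel \<Otimes>\<^sub>M G) (\<lambda>\<omega>. (Y \<omega>, \<omega>))) (A \<times> B)"
      using A B Y id pre B'
      by (simp add: emeasure_distr emeasure_eq_measure ennreal_mult measure_nonneg)
  qed (simp_all add: Y.sigma_finite_measure_axioms I.sigma_finite_measure_axioms cong: sets_pair_measure_cong)
  have E': "E \<in> sets (distr M borel Y \<Otimes>\<^sub>M distr M G (\<lambda>\<omega>. \<omega>))"
    using E by (simp cong: sets_pair_measure_cong)
  have "emeasure M {\<omega> \<in> space M. (Y \<omega>, \<omega>) \<in> E} = emeasure (distr M (borel \<Otimes>\<^sub>M G) (\<lambda>\<omega>. (Y \<omega>, \<omega>))) E"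
    using E Y id by (subst emeasure_distr) (auto intro!: arg_cong2[where f=emeasure])
  also have "\<dots> = (\<integral>\<^sup>+\<omega>. emeasure (distr M borel Y) ((\<lambda>v. (v, \<omega>)) -` E) \<partial>distr M G (\<lambda>\<omega>. \<omega>))"
    unfolding joint[symmetric] by (rule emeasure_pair_measure_alt2[OF E'])
  \<comment> \<open>The outer integral returns to \<open>M\<close>, the measure for which
    \<open>le\<close> holds almost everywhere.\<close>
  also have "\<dots> = (\<integral>\<^sup>+\<omega>. emeasure (distr M borel Y) ((\<lambda>v. (v, \<omega>)) -` E) \<partial>M)"
    using measurable_emeasure_Pair2[OF E'] id by (subst nn_integral_distr) (simp_all cong: measurable_cong_sets)
  also have "\<dots> \<le> (\<integral>\<^sup>+\<omega>. c \<partial>M)"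
    using le by (intro nn_integral_mono_AE) (simp add: vimage_def)
  also have "\<dots> = c" by (simp add: emeasure_space_1)
  finally show ?thesis .
qed

section \<open>Measurability of closeness to a random span\<close>

text \<open>The distance to a combination is continuous in the coefficients, so a non-strict lower
  bound passes from rational tuples to their limits. This reduces the test on the whole span to
  countably many conditions.\<close>

lemma rational_coefficients_suffice:
  fixes q :: "nat \<Rightarrow> 'a::real_normed_vector"
  assumes "\<And>a. a \<in> PiE {1..k} (\<lambda>_. \<rat>) \<Longrightarrow> c \<le> norm (z - (\<Sum>j=1..k. a j *\<^sub>R q j))"
  shows "c \<le> norm (z - (\<Sum>j=1..k. a j *\<^sub>R q j))"
proof -
  have "\<exists>r\<in>\<rat>. a j < r \<and> r < a j + inverse (real (Suc n))" for j n
    by (rule Rats_dense_in_real) simp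
  then obtain r where r: "\<And>j n. r j n \<in> \<rat>" "\<And>j n. a j < r j n" "\<And>j n. r j n < a j + inverse (real (Suc n))"
    by metis
  have lim: "(\<lambda>n. r j n) \<longlonglongrightarrow> a j" for j
  proof (rule tendsto_sandwich[OF _ _ tendsto_const])
    show "(\<lambda>n. a j + inverse (real (Suc n))) \<longlonglongrightarrow> a j"
      by (rule LIMSEQ_inverse_real_of_nat_add)
  qed (use r in \<open>auto intro!: always_eventually less_imp_le\<close>)
  have "(\<lambda>n. norm (z - (\<Sum>j=1..k. r j n *\<^sub>R q j))) \<longlonglongrightarrow> norm (z - (\<Sum>j=1..k. a j *\<^sub>R q j))"
    by (intro tendsto_intros lim)
  moreover have "c \<le> norm (z - (\<Sum>j=1..k. r j n *\<^sub>R q j))" for n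
    using assms[of "\<lambda>j\<in>{1..k}. r j n"] r(1) by auto
  ultimately show ?thesis
    by (intro LIMSEQ_le_const) auto
qed

text \<open>A countable union over rational tuples. The strict inequality makes the complement a
  non-strict bound, as \<open>rational_coefficients_suffice\<close> requires; it can never hold when
  \<open>x \<omega> + v = 0\<close>, so that case is added separately.\<close>

lemma sets_near_span_event:
  fixes q :: "nat \<Rightarrow> 'w \<Rightarrow> real^'m"
  assumes [measurable]: "x \<in> borel_measurable G" and q: "\<And>j. j \<in> {1..k} \<Longrightarrow> q j \<in> borel_measurable G"
  shows "{(v, \<omega>). \<omega> \<in> space G \<and> (x \<omega> + v = 0 \<or>
      (\<exists>a\<in>PiE {1..k} (\<lambda>_. \<rat>). norm (x \<omega> + v - (\<Sum>j=1..k. a j *\<^sub>R q j \<omega>)) < \<tau> * norm (x \<omega> + v)))}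
    \<in> sets (borel \<Otimes>\<^sub>M G)" (is "?E \<in> _")
proof -
  have S [measurable]: "(\<lambda>\<omega>. \<Sum>j=1..k. a j *\<^sub>R q j \<omega>) \<in> borel_measurable G" for a
    using q by (intro borel_measurable_sum borel_measurable_scaleR) auto
  have "countable (PiE {1..k} (\<lambda>_. \<rat> :: real set))"
    by (intro countable_PiE countable_rat) auto
  then have "{p \<in> space (borel \<Otimes>\<^sub>M G). x (snd p) + fst p = 0 \<or>
      (\<exists>a\<in>PiE {1..k} (\<lambda>_. \<rat>). norm (x (snd p) + fst p - (\<Sum>j=1..k. a j *\<^sub>R q j (snd p))) < \<tau> * norm (x (snd p) + fst p))}
    \<in> sets (borel \<Otimes>\<^sub>M G)"
    by (intro sets.sets_Collect_disj sets.sets_Collect_countable_Bex) measurable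
  also have "{p \<in> space (borel \<Otimes>\<^sub>M G). x (snd p) + fst p = 0 \<or>
      (\<exists>a\<in>PiE {1..k} (\<lambda>_. \<rat>). norm (x (snd p) + fst p - (\<Sum>j=1..k. a j *\<^sub>R q j (snd p))) < \<tau> * norm (x (snd p) + fst p))} = ?E"
    by (auto simp: space_pair_measure)
  finally show ?thesis .
qed

lemma borel_measurable_vec_lambda:
  fixes f :: "'a \<Rightarrow> 'i::finite \<Rightarrow> 'b::euclidean_space"
  assumes "\<And>i. (\<lambda>\<omega>. f \<omega> i) \<in> borel_measurable M"
  shows "(\<lambda>\<omega>. \<chi> i. f \<omega> i) \<in> borel_measurable M"
proof (rule borel_measurable_euclidean_space[THEN iffD2], intro ballI)
  fix b :: "'b^'i" assume "b \<in> Basis"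
  then obtain i u where "b = axis i u" by (auto simp: Basis_vec_def)
  then show "(\<lambda>\<omega>. (\<chi> i. f \<omega> i) \<bullet> b) \<in> borel_measurable M"
    using assms by (simp add: inner_axis)
qed

section \<open>Exceptional events for the single columns and their union bound\<close>

theorem corollary7p5:
  fixes M :: "'w measure"
    and m n :: nat
    and \<sigma> :: real
    and q x y :: "nat \<Rightarrow> 'w \<Rightarrow> real^'m"
    and q1 :: "real^'m"
    and \<tau> l :: "nat \<Rightarrow> real"
    and pos :: "'n::finite \<Rightarrow> nat"
  assumes "prob_space M"
    and "CARD('m) = m" and "CARD('n) = n"
    and "bij_betw pos (UNIV :: 'n set) {1..n}"
    and "\<sigma> > 0" and "n \<ge> 2" and "m \<ge> n"
    and "norm q1 = 1"
    and "\<forall>\<omega>\<in>space M. q 1 \<omega> = q1"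
    and "\<forall>i\<in>{2..n}. \<forall>\<omega>\<in>space M.
           q i \<omega> = (1 / norm (x i \<omega> + y i \<omega>)) *\<^sub>R (x i \<omega> + y i \<omega>)"
    and "\<forall>i\<in>{2..n}. AE \<omega> in M. x i \<omega> \<in> (column_space (\<lambda>j. q j \<omega>) (i - 1))\<^sup>\<bottom>"
    and "\<forall>i\<in>{2..n}. AE \<omega> in M. full_column_rank (\<lambda>j. q j \<omega>) (i - 1)"
    and "\<forall>i\<in>{2..n}. x i \<in> borel_measurable (generated_sigma M y (i - 1))"
    and "\<forall>i\<in>{2..n}. y i \<in> borel_measurable M"
    and "\<forall>i\<in>{2..n}. distr M borel (y i) = isotropic_gaussian \<sigma>"
    and "\<forall>i\<in>{2..n}. prob_space.indep_set M
           (sets (vimage_algebra (space M) (y i) borel)) (sets (generated_sigma M y (i - 1)))"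
    and "\<forall>i\<in>{2..n}. 0 < \<tau> i \<and> \<tau> i < 1"
    and "\<forall>i\<in>{2..n}. 0 < l i"
    and "\<forall>i\<in>{2..n}. AE \<omega> in M. norm (x i \<omega>) \<ge> l i"
  shows "measure M {\<omega> \<in> space M.
             cond_number (matrix_of_columns pos (\<lambda>j. q j \<omega>))
               \<le> ereal (\<Prod>i=2..n. (1 + sqrt (1 - (\<tau> i)\<^sup>2)) / \<tau> i)}
         \<ge> 1 - (\<Sum>i=2..n.
             cdf (noncentral_F (m - i + 1) (i - 1) ((l i)\<^sup>2 / \<sigma>\<^sup>2))
               ((real (i - 1) * (\<tau> i)\<^sup>2) / (real (m - i + 1) * (1 - (\<tau> i)\<^sup>2))))"
proof -
  interpret prob_space M by fact
  note card = assms(2,3) and pos = assms(4) and \<sigma> = assms(5) and n = assms(6,7) and q1 = assms(8,9)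
  have q: "q i \<omega> = (1 / norm (x i \<omega> + y i \<omega>)) *\<^sub>R (x i \<omega> + y i \<omega>)" if "i \<in> {2..n}" "\<omega> \<in> space M" for i \<omega>
    using assms(10) that by blast
  have perp: "AE \<omega> in M. x i \<omega> \<in> (column_space (\<lambda>j. q j \<omega>) (i - 1))\<^sup>\<bottom>" if "i \<in> {2..n}" for i
    using assms(11) that by blast
  have rank: "AE \<omega> in M. full_column_rank (\<lambda>j. q j \<omega>) (i - 1)" if "i \<in> {2..n}" for i
    using assms(12) that by blast
  have x: "x i \<in> borel_measurable (generated_sigma M y (i - 1))" if "i \<in> {2..n}" for i
    using assms(13) that by blast
  have y: "y i \<in> borel_measurable M" if "i \<in> {2..n}" for i
    using assms(14) that by blast
  have law: "distr M borel (y i) = isotropic_gaussian \<sigma>" if "i \<in> {2..n}" for i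
    using assms(15) that by blast
  have ind: "indep_set (sets (vimage_algebra (space M) (y i) borel)) (sets (generated_sigma M y (i - 1)))" if "i \<in> {2..n}" for i
    using assms(16) that by blast
  have \<tau>: "0 < \<tau> i" "\<tau> i < 1" if "i \<in> {2..n}" for i
    using assms(17) that by blast+
  have l: "0 < l i" "AE \<omega> in M. l i \<le> norm (x i \<omega>)" if "i \<in> {2..n}" for i
    using assms(18,19) that by blast+
  have q1_eq: "q 1 \<omega> = q1" if "\<omega> \<in> space M" for \<omega> using q1 that by blast

  let ?G = "\<lambda>i. generated_sigma M y (i - 1)"
  let ?p = "\<lambda>i. cdf (noncentral_F (m - i + 1) (i - 1) ((l i)\<^sup>2 / \<sigma>\<^sup>2))
               ((real (i - 1) * (\<tau> i)\<^sup>2) / (real (m - i + 1) * (1 - (\<tau> i)\<^sup>2)))"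
  \<comment> \<open>The bound is \<open>Suc k\<close> because \<open>x j\<close> depends only on
    perturbations with index below \<open>j\<close>, whereas \<open>q j\<close> also involves
    \<open>y j\<close> and needs \<open>j \<le> k\<close>.\<close>
  have xG: "x j \<in> borel_measurable (generated_sigma M y k)" if "j \<in> {2..n}" "j \<le> Suc k" for j k
  proof (rule measurable_from_subalg[OF _ x[OF that(1)]])
    show "subalgebra (generated_sigma M y k) (?G j)"
      using that sets_generated_sigma_mono[of "j - 1" k M y] by (simp add: subalgebra_def)
  qed
  have qG: "q j \<in> borel_measurable (generated_sigma M y k)" if "j \<in> {1..n}" "j \<le> k" for j k
  proof (cases "j = 1")
    case True
    have "(\<lambda>_. q1) \<in> borel_measurable (generated_sigma M y k)" by simp
    then show ?thesis unfolding True by (subst measurable_cong[where g="\<lambda>_. q1"]) (auto simp: q1_eq simp del: One_nat_def)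
  next
    case False
    with that have j: "j \<in> {2..n}" "j \<in> {2..k}" by auto
    have [measurable]: "x j \<in> borel_measurable (generated_sigma M y k)" using xG j by auto
    have [measurable]: "y j \<in> borel_measurable (generated_sigma M y k)"
      by (rule measurable_generated_sigma[OF j(2)])
    have "(\<lambda>\<omega>. (1 / norm (x j \<omega> + y j \<omega>)) *\<^sub>R (x j \<omega> + y j \<omega>)) \<in> borel_measurable (generated_sigma M y k)"
      by measurable
    then show ?thesis by (subst measurable_cong[OF q[OF j(1)]]) simp_all
  qed
  \<comment> \<open>The current perturbation is a free variable \<open>v\<close> here, and
    everything else depends on the past alone; this product form lets independence enter through
    Fubini.\<close>
  define E where "E i = {(v, \<omega>). \<omega> \<in> space (?G i) \<and> (x i \<omega> + v = 0 \<or>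
      (\<exists>a\<in>PiE {1..i-1} (\<lambda>_. \<rat>). norm (x i \<omega> + v - (\<Sum>j=1..i-1. a j *\<^sub>R q j \<omega>)) < \<tau> i * norm (x i \<omega> + v)))}" for i
  have E: "E i \<in> sets (borel \<Otimes>\<^sub>M ?G i)" if "i \<in> {2..n}" for i
    unfolding E_def using that by (intro sets_near_span_event x qG) auto
  have GM: "sets (?G i) \<subseteq> sets M" if "i \<in> {2..n}" for i
    using that y by (intro sets_generated_sigma_subset) auto
  define bad where "bad i = {\<omega> \<in> space M. (y i \<omega>, \<omega>) \<in> E i}" for i

  have bad_sets: "bad i \<in> sets M" if i: "i \<in> {2..n}" for i
  proof -
    have "(\<lambda>\<omega>. \<omega>) \<in> measurable M (?G i)"
      using GM[OF i] by (intro measurableI) (auto simp: Int_absorb2 dest: sets.sets_into_space)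
    then have "(\<lambda>\<omega>. (y i \<omega>, \<omega>)) \<in> measurable M (borel \<Otimes>\<^sub>M ?G i)"
      using y[OF i] by (rule measurable_Pair[rotated])
    from measurable_sets[OF this E[OF i]] show ?thesis
      by (simp add: bad_def vimage_def Int_def conj_commute)
  qed
  have bad_le: "measure M (bad i) \<le> ?p i" if i: "i \<in> {2..n}" for i
  proof -
    have "emeasure M (bad i) \<le> ennreal (?p i)"
      unfolding bad_def
    proof (rule prob_le_if_sections_le[OF space_generated_sigma GM[OF i] y[OF i] ind[OF i] E[OF i]])
      show "AE \<omega> in M. emeasure (distr M borel (y i)) {v. (v, \<omega>) \<in> E i} \<le> ennreal (?p i)"
        using perp[OF i] rank[OF i] l(2)[OF i]
      proof eventually_elim
        case (elim \<omega>)
        let ?W = "column_space (\<lambda>j. q j \<omega>) (i - 1)"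
        have W: "subspace ?W" by (simp add: column_space_def)
        have "emeasure (isotropic_gaussian \<sigma>) {v. (v, \<omega>) \<in> E i}
          \<le> ennreal (cdf (noncentral_F (CARD('m) - (i - 1)) (i - 1) ((l i)\<^sup>2 / \<sigma>\<^sup>2))
               ((real (i - 1) * (\<tau> i)\<^sup>2) / (real (CARD('m) - (i - 1)) * (1 - (\<tau> i)\<^sup>2))))"
        proof (rule gaussian_near_subspace[OF W _ _ _ \<sigma> \<tau>[OF i] l(1)[OF i] elim(3)])
          show "dim ?W = i - 1" using elim by (simp add: full_column_rank_def)
          show "1 \<le> i - 1" "i - 1 < CARD('m)" using i n card by auto
          show "w \<bullet> x i \<omega> = 0" if "w \<in> ?W" for w
            using elim(1) that by (auto simp: orthogonal_comp_def orthogonal_def)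
          fix v assume "v \<in> {v. (v, \<omega>) \<in> E i}"
          then consider "x i \<omega> + v = 0"
            | a where "norm (x i \<omega> + v - (\<Sum>j=1..i-1. a j *\<^sub>R q j \<omega>)) < \<tau> i * norm (x i \<omega> + v)"
            by (auto simp: E_def)
          then show "\<exists>w\<in>?W. norm (x i \<omega> + v - w) \<le> \<tau> i * norm (x i \<omega> + v)"
          proof cases
            case 1
            then show ?thesis using subspace_0[OF W] by (intro bexI[of _ 0]) auto
          next
            case 2
            have "(\<Sum>j=1..i-1. a j *\<^sub>R q j \<omega>) \<in> ?W"
              unfolding column_space_def by (intro span_sum span_scale span_base) auto
            with 2 show ?thesis by (intro bexI) auto
          qed
        qed
        \<comment> \<open>The truncated subtractions agree because \<open>2 \<le> i\<close> and
          \<open>i \<le> n \<le> m\<close>.\<close>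
        also have "CARD('m) - (i - 1) = m - i + 1" using i n card by auto
        finally show ?case unfolding law[OF i] .
      qed
    qed
    moreover have "0 \<le> ?p i" by (simp add: cdf_def)
    ultimately show ?thesis by (simp add: emeasure_eq_measure)
  qed

  let ?good = "{\<omega> \<in> space M. cond_number (matrix_of_columns pos (\<lambda>j. q j \<omega>))
               \<le> ereal (\<Prod>i=2..n. (1 + sqrt (1 - (\<tau> i)\<^sup>2)) / \<tau> i)}"
  have le: "CARD('n) \<le> CARD('m)" using card n by simp
  have good: "\<omega> \<in> ?good" if \<omega>: "\<omega> \<in> space M - (\<Union>i\<in>{2..n}. bad i)" for \<omega>
  proof -
    have far: "norm (q i \<omega>) = 1 \<and> (\<forall>a. \<tau> i \<le> norm (q i \<omega> - (\<Sum>j=1..i-1. a j *\<^sub>R q j \<omega>)))" if i: "i \<in> {2..n}" for i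
    proof -
      let ?z = "x i \<omega> + y i \<omega>"
      have nb: "(y i \<omega>, \<omega>) \<notin> E i" using \<omega> i by (auto simp: bad_def)
      then have z: "?z \<noteq> 0" using \<omega> by (auto simp: E_def)
      have qz: "q i \<omega> = (1 / norm ?z) *\<^sub>R ?z" using q[OF i] \<omega> by simp
      have "\<tau> i \<le> norm (q i \<omega> - (\<Sum>j=1..i-1. a j *\<^sub>R q j \<omega>))" for a
      proof -
        \<comment> \<open>Scaling the coefficients by \<open>norm ?z\<close> turns the bound for the
          unnormalized vector into one for the column.\<close>
        have "\<tau> i * norm ?z \<le> norm (?z - (\<Sum>j=1..i-1. (norm ?z * a j) *\<^sub>R q j \<omega>))"
          by (rule rational_coefficients_suffice) (use nb \<omega> in \<open>force simp: E_def\<close>)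
        also have "?z - (\<Sum>j=1..i-1. (norm ?z * a j) *\<^sub>R q j \<omega>) = norm ?z *\<^sub>R (q i \<omega> - (\<Sum>j=1..i-1. a j *\<^sub>R q j \<omega>))"
          using z by (simp add: qz scaleR_diff_right scaleR_sum_right)
        finally show ?thesis using z by (simp add: mult.commute)
      qed
      moreover have "norm (q i \<omega>) = 1" using z by (simp add: qz)
      ultimately show ?thesis by blast
    qed
    have "cond_number (matrix_of_columns pos (\<lambda>j. q j \<omega>)) \<le> ereal (\<Prod>i=2..n. (1 + sqrt (1 - (\<tau> i)\<^sup>2)) / \<tau> i)"
      using far \<tau> n q1_eq[of \<omega>] q1(1) \<omega> by (intro cond_number_le_prod[OF le pos]) (auto simp del: One_nat_def)
    then show ?thesis using \<omega> by simp
  qed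
  have "matrix_of_columns pos (\<lambda>j. q j \<omega>) = (\<chi> r j. q (pos j) \<omega> $ r)" for \<omega>
    by (simp add: matrix_of_columns_def)
  moreover have "(\<lambda>\<omega>. \<chi> r j. q (pos j) \<omega> $ r) \<in> borel_measurable M"
  proof (intro borel_measurable_vec_lambda)
    fix r j
    have "pos j \<in> {1..n}" using pos by (auto simp: bij_betw_def)
    then have "q (pos j) \<in> borel_measurable (generated_sigma M y n)" by (intro qG) auto
    moreover have "subalgebra M (generated_sigma M y n)"
      using y sets_generated_sigma_subset[of n y M] by (simp add: subalgebra_def)
    ultimately have qM: "q (pos j) \<in> borel_measurable M"
      by (rule measurable_from_subalg[rotated])
    show "(\<lambda>\<omega>. q (pos j) \<omega> $ r) \<in> borel_measurable M"
      by (rule measurable_compose[OF qM borel_measurable_continuous_onI]) (intro continuous_intros)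
  qed
  ultimately have "(\<lambda>\<omega>. matrix_of_columns pos (\<lambda>j. q j \<omega>)) \<in> borel_measurable M" by simp
  \<comment> \<open>Monotonicity of \<open>measure\<close> in the last step requires the larger
    event to be measurable.\<close>
  from measurable_sets[OF this cond_number_le_borel[OF le]] have good_sets: "?good \<in> sets M"
    by (simp add: vimage_def Int_def conj_commute)
  have "1 - (\<Sum>i=2..n. ?p i) \<le> 1 - (\<Sum>i=2..n. measure M (bad i))"
    using bad_le by (intro diff_left_mono sum_mono) auto
  also have "\<dots> \<le> 1 - measure M (\<Union>i\<in>{2..n}. bad i)"
    using bad_sets by (intro diff_left_mono measure_UNION_le) auto
  also have "\<dots> = measure M (space M - (\<Union>i\<in>{2..n}. bad i))"
    using bad_sets by (intro prob_compl[symmetric] sets.finite_UN) auto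
  also have "\<dots> \<le> measure M ?good"
    using good good_sets by (intro finite_measure_mono) auto
  finally show ?thesis .
qed

end
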